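(* Let $q$ be a prime power, $n\ge5$ an odd integer, $g=(q-1)(q^{n+1}+q^n-q^2)/2$ and $N=q^{2n+2}-q^{n+3}+q^{n+2}$. For all integers $\ell\in[3g-1,N-g]$ and $s\in[1,N-2\ell]$, there exists a quantum code with parameters $[[N,s,D]]_{q^{2n}}$, where $D\ge\ell+1-g$.
   Context: For a prime power $Q$, a $Q$-ary quantum code of length $N$ and dimension $k$ is a $Q^k$-dimensional Hilbert subspace of $(\mathbb C^Q)^{\otimes N}$; $[[N,k,D]]_Q$ denotes such a code with minimum distance $D$ (a code of minimum distance $D$ can correct up to $\lfloor (D-1)/2\rfloor$ quantum errors). The standard CSS construction says: if $C_1\subset C_2$ are linear codes over $\mathbb F_Q$ of length $N$ and dimensions $k_1,k_2$, then there exists an $[[N,k_2-k_1,D]]_Q$ code with $D=\min\{wt(c)\mid c\in(C_2\setminus C_1)\cup(C_1^\perp\setminus C_2^\perp)\}$, where $wt$ is the Hamming weight. (If $N-2\ell<1$ there is no admissible $s$.) *)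

theory Defs
  imports Complex_Main "HOL-Library.FuncSet" "HOL-Library.Function_Algebras"
    "HOL-Number_Theory.Prime_Powers"
begin

(* (C^Q)^{\<otimes>N} is modelled as the space of complex functions on its standard basis
   |w_0 ... w_{N-1}>, i.e. on the words of length N over {0..<Q}; the functions vanish off the
   words so that each vector has exactly one representative. *)

definition words :: "nat \<Rightarrow> nat \<Rightarrow> (nat \<Rightarrow> nat) set" where
  "words Q N = {..<N} \<rightarrow>\<^sub>E {..<Q}"

type_synonym state = "(nat \<Rightarrow> nat) \<Rightarrow> complex"

definition state_space :: "nat \<Rightarrow> nat \<Rightarrow> state set" where
  "state_space Q N = {\<psi>. \<forall>w. w \<notin> words Q N \<longrightarrow> \<psi> w = 0}"

definition cscale :: "complex \<Rightarrow> state \<Rightarrow> state" where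
  "cscale c \<psi> = (\<lambda>w. c * \<psi> w)"

global_interpretation cvs: vector_space cscale
  by unfold_locales (auto simp: cscale_def fun_eq_iff algebra_simps)

definition braket :: "nat \<Rightarrow> nat \<Rightarrow> state \<Rightarrow> state \<Rightarrow> complex" where
  "braket Q N \<phi> \<psi> = (\<Sum>w\<in>words Q N. cnj (\<phi> w) * \<psi> w)"

(* An error is a tensor product E 0 \<otimes> ... \<otimes> E (N-1), where E i is an arbitrary complex Q x Q matrix
   with entries E i a b (row a, column b) acting on the i-th qudit.  Every operator acting on at
   most w qudits is a linear combination of such products of weight at most w (a Pauli basis, for
   instance), and detectability below is preserved by linear combinations, so restricting to a
   fixed error basis or admitting all operators yields the same minimum distance. *)

type_synonym product_error = "nat \<Rightarrow> nat \<Rightarrow> nat \<Rightarrow> complex"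

definition apply_error :: "nat \<Rightarrow> nat \<Rightarrow> product_error \<Rightarrow> state \<Rightarrow> state" where
  "apply_error Q N E \<psi> = (\<lambda>x. if x \<in> words Q N
      then \<Sum>y\<in>words Q N. (\<Prod>i<N. E i (x i) (y i)) * \<psi> y else 0)"

definition error_weight :: "nat \<Rightarrow> nat \<Rightarrow> product_error \<Rightarrow> nat" where
  "error_weight Q N E =
     card {i. i < N \<and> (\<exists>a<Q. \<exists>b<Q. E i a b \<noteq> (if a = b then 1 else 0))}"

(* The Knill-Laflamme detection condition P E P = c P, with P the orthogonal projector onto V,
   written in matrix elements. *)
definition detectable :: "nat \<Rightarrow> nat \<Rightarrow> state set \<Rightarrow> product_error \<Rightarrow> bool" where
  "detectable Q N V E \<longleftrightarrow>
     (\<exists>c. \<forall>u\<in>V. \<forall>v\<in>V. braket Q N u (apply_error Q N E v) = c * braket Q N u v)"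

definition has_min_distance :: "nat \<Rightarrow> nat \<Rightarrow> state set \<Rightarrow> nat \<Rightarrow> bool" where
  "has_min_distance Q N V D \<longleftrightarrow>
     (\<exists>E. error_weight Q N E = D \<and> \<not> detectable Q N V E) \<and>
     (\<forall>E. error_weight Q N E < D \<longrightarrow> detectable Q N V E)"

(* V is an [[N,k,D]]_Q code. *)
definition quantum_code :: "nat \<Rightarrow> nat \<Rightarrow> nat \<Rightarrow> nat \<Rightarrow> state set \<Rightarrow> bool" where
  "quantum_code Q N k D V \<longleftrightarrow>
     V \<subseteq> state_space Q N \<and> cvs.subspace V \<and> cvs.dim V = Q ^ k \<and> has_min_distance Q N V D"

end

theory Submission
  imports Defs "HOL-Algebra.Algebraic_Closure_Type" "Berlekamp_Zassenhaus.Finite_Field"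
begin

text \<open>
  The codes come from the CSS construction applied to one-point codes on the curve
  \<open>x^q + x = y^(q+1)\<close>, \<open>y^(q^2) - y = z^m\<close> with \<open>m = (q^n+1)/(q+1)\<close>, which has \<open>N\<close> affine points over
  the field with \<open>q^(2n)\<close> elements. Neither Riemann-Roch nor duality is needed. Write \<open>L(r)\<close> for the
  functions of pole order at most \<open>r\<close>, \<open>S\<close> for the semigroup of pole orders, which has at most \<open>g\<close>
  gaps, and \<open>\<Delta>\<close> for the set of orders \<open>r\<close> at which the restriction of \<open>L(r)\<close> to a set \<open>T\<close> of points
  grows; then \<open>\<Delta>\<close> has \<open>|T|\<close> elements. If \<open>u + v\<close> is in \<open>\<Delta>\<close> for \<open>u, v\<close> in \<open>S\<close>, then so is \<open>u\<close>. Counting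
  the decompositions of an element of \<open>\<Delta>\<close> bounds it by \<open>|T| + 2g - 1\<close>, so \<open>L(r)\<close> takes arbitrary values
  on \<open>T\<close> once \<open>r \<ge> |T| + 2g - 1\<close>. If \<open>r\<close> in \<open>S\<close> is not in \<open>\<Delta>\<close>, then \<open>\<Delta>\<close> misses \<open>r + S\<close>, so \<open>|T| \<le> r\<close>;
  hence a nonzero function of pole order \<open>r\<close> has at most \<open>r\<close> zeros. The nested pair
  \<open>L(l + g - 1) \<subseteq> L(l + g - 1 + s)\<close> gives the code.
\<close>

hide_const (open) Divisibility.prime Polynomials.degree Polynomials.lead_coeff
  up_ring.monom up_ring.coeff

section \<open>Quantum codes from partitions of words\<close>

lemma sum_fun_apply: "(\<Sum>a\<in>A. f a) x = (\<Sum>a\<in>A. f a x)"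
  for f :: "'a \<Rightarrow> 'b \<Rightarrow> 'c::comm_monoid_add"
  by (induction A rule: infinite_finite_induct) auto

lemma finite_words: "finite (words Q N)"
  unfolding words_def by (intro finite_PiE) auto

text \<open>The tensor product of the matrix units |x_i><y_i| is the matrix unit |x><y|.
  \<open>ex_undetectable\<close> uses it as its error.\<close>

lemma amplitude_matrix_unit:
  assumes "x \<in> words Q N" "y \<in> words Q N" "x' \<in> words Q N" "y' \<in> words Q N"
  shows "(\<Prod>i<N. if x' i = x i \<and> y' i = y i then 1 else (0::complex)) =
    (if x' = x \<and> y' = y then 1 else 0)"
proof (cases "x' = x \<and> y' = y")
  case False
  then obtain i where "i < N" "\<not> (x' i = x i \<and> y' i = y i)"
    using assms unfolding words_def by (metis PiE_ext lessThan_iff)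
  then have "(\<Prod>i<N. if x' i = x i \<and> y' i = y i then 1 else (0::complex)) = 0"
    by (intro prod_zero) auto
  with False show ?thesis by simp
qed simp

text \<open>The combinatorial content of a CSS code: the blocks stand for the cosets of
  \<open>C1\<close> in \<open>C2\<close>. \<open>separated\<close> controls the off-diagonal part of
  an error and \<open>marginals\<close> its diagonal part. A one-dimensional code detects every
  error, so \<open>Q ^ k > 1\<close> ensures that a minimum distance exists.\<close>

locale word_partition =
  fixes Q N k d :: nat and \<P> :: "(nat \<Rightarrow> nat) set set"
  assumes blocks: "A \<in> \<P> \<Longrightarrow> A \<subseteq> words Q N" "A \<in> \<P> \<Longrightarrow> A \<noteq> {}"
    and disjoint: "A \<in> \<P> \<Longrightarrow> B \<in> \<P> \<Longrightarrow> A \<noteq> B \<Longrightarrow> A \<inter> B = {}"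
    and card_blocks: "card \<P> = Q ^ k" "Q ^ k > 1"
    and d_pos: "d > 0"
    and separated: "x \<in> \<Union>\<P> \<Longrightarrow> y \<in> \<Union>\<P> \<Longrightarrow> x \<noteq> y \<Longrightarrow> d \<le> card {i. i < N \<and> x i \<noteq> y i}"
    and marginals: "T \<subseteq> {..<N} \<Longrightarrow> card T < d \<Longrightarrow> A \<in> \<P> \<Longrightarrow> B \<in> \<P> \<Longrightarrow>
      card {x \<in> A. restrict x T = v} = card {x \<in> B. restrict x T = v}"
begin

section \<open>The code spanned by the unnormalised superpositions of the blocks\<close>

definition block_state :: "(nat \<Rightarrow> nat) set \<Rightarrow> state" where
  "block_state A = (\<lambda>w. if w \<in> A then 1 else 0)"

definition block_code :: "state set" where
  "block_code = {\<psi>. (\<forall>w. w \<notin> \<Union>\<P> \<longrightarrow> \<psi> w = 0) \<and> (\<forall>A\<in>\<P>. \<forall>x\<in>A. \<forall>y\<in>A. \<psi> x = \<psi> y)}"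

lemma block_codeI:
  assumes "\<And>w. w \<notin> \<Union>\<P> \<Longrightarrow> \<psi> w = 0" "\<And>A x y. A \<in> \<P> \<Longrightarrow> x \<in> A \<Longrightarrow> y \<in> A \<Longrightarrow> \<psi> x = \<psi> y"
  shows "\<psi> \<in> block_code"
  unfolding block_code_def using assms by blast

lemma block_codeD:
  assumes "\<psi> \<in> block_code"
  shows "w \<notin> \<Union>\<P> \<Longrightarrow> \<psi> w = 0" "A \<in> \<P> \<Longrightarrow> x \<in> A \<Longrightarrow> y \<in> A \<Longrightarrow> \<psi> x = \<psi> y"
  using assms unfolding block_code_def by blast+

lemma finite_blocks: "finite \<P>"
  using card_blocks by (intro card_ge_0_finite) linarith

lemma finite_block: "A \<in> \<P> \<Longrightarrow> finite A"
  using blocks(1) finite_words finite_subset by blast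

lemma Union_subset: "\<Union>\<P> \<subseteq> words Q N"
  using blocks(1) by blast

lemma block_state_in: "A \<in> \<P> \<Longrightarrow> block_state A \<in> block_code"
  using disjoint by (intro block_codeI) (fastforce simp: block_state_def)+

lemma sum_block_state:
  assumes "A \<in> \<P>" "x \<in> A"
  shows "(\<Sum>B\<in>\<P>. c B * block_state B x) = c A"
proof -
  have "c B * block_state B x = (if B = A then c A else 0)" if "B \<in> \<P>" for B
    using assms that disjoint[of A B] by (auto simp: block_state_def)
  then have "(\<Sum>B\<in>\<P>. c B * block_state B x) = (\<Sum>B\<in>\<P>. if B = A then c A else 0)"
    by (intro sum.cong) auto
  then show ?thesis
    using assms finite_blocks by simp
qed

lemma subspace_block_code: "cvs.subspace block_code"
proof (rule cvs.subspaceI)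
  show "0 \<in> block_code"
    by (rule block_codeI) simp_all
next
  fix \<phi> \<psi> assume *: "\<phi> \<in> block_code" "\<psi> \<in> block_code"
  show "\<phi> + \<psi> \<in> block_code"
  proof (rule block_codeI)
    fix A x y assume "A \<in> \<P>" "x \<in> A" "y \<in> A"
    then show "(\<phi> + \<psi>) x = (\<phi> + \<psi>) y"
      using block_codeD(2)[OF *(1)] block_codeD(2)[OF *(2)] by (metis plus_fun_apply)
  qed (use block_codeD(1)[OF *(1)] block_codeD(1)[OF *(2)] in simp)
next
  fix c \<psi> assume *: "\<psi> \<in> block_code"
  show "cscale c \<psi> \<in> block_code"
  proof (rule block_codeI)
    fix A x y assume "A \<in> \<P>" "x \<in> A" "y \<in> A"
    then show "cscale c \<psi> x = cscale c \<psi> y"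
      using block_codeD(2)[OF *] by (metis cscale_def)
  qed (use block_codeD(1)[OF *] in \<open>simp add: cscale_def\<close>)
qed

lemma dim_block_code: "cvs.dim block_code = Q ^ k"
proof (rule cvs.dim_unique)
  have inj: "inj_on block_state \<P>"
  proof (rule inj_onI)
    fix A B assume "A \<in> \<P>" "B \<in> \<P>" and eq: "block_state A = block_state B"
    show "A = B"
    proof (rule Set.set_eqI)
      fix w show "w \<in> A \<longleftrightarrow> w \<in> B"
        using fun_cong[OF eq, of w] by (auto simp: block_state_def split: if_splits)
    qed
  qed
  show "card (block_state ` \<P>) = Q ^ k"
    using inj card_blocks by (simp add: card_image)
  show "block_state ` \<P> \<subseteq> block_code"
    using block_state_in by auto
  show "cvs.independent (block_state ` \<P>)"
  proof (rule cvs.independent_if_scalars_zero)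
    show "finite (block_state ` \<P>)"
      using finite_blocks by simp
  next
    fix f \<psi> assume 0: "(\<Sum>\<psi>\<in>block_state ` \<P>. cscale (f \<psi>) \<psi>) = 0" and "\<psi> \<in> block_state ` \<P>"
    then obtain A x where A: "A \<in> \<P>" "\<psi> = block_state A" "x \<in> A"
      using blocks(2) by blast
    have "0 = (\<Sum>B\<in>\<P>. cscale (f (block_state B)) (block_state B)) x"
      using 0 by (simp add: sum.reindex[OF inj])
    also have "\<dots> = (\<Sum>B\<in>\<P>. f (block_state B) * block_state B x)"
      by (simp add: sum_fun_apply cscale_def)
    also have "\<dots> = f \<psi>"
      using sum_block_state[OF A(1,3), of "\<lambda>B. f (block_state B)"] A(2) by simp
    finally show "f \<psi> = 0" by simp
  qed
  show "block_code \<subseteq> cvs.span (block_state ` \<P>)"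
  proof
    fix \<psi> assume \<psi>: "\<psi> \<in> block_code"
    define c where "c B = \<psi> (SOME y. y \<in> B)" for B
    have c: "c A = \<psi> x" if "A \<in> \<P>" "x \<in> A" for A x
      unfolding c_def using block_codeD(2)[OF \<psi> that(1) _ that(2)]
        someI[of "\<lambda>y. y \<in> A", OF that(2)] by blast
    have "\<psi> = (\<Sum>B\<in>\<P>. cscale (c B) (block_state B))"
    proof
      fix w
      show "\<psi> w = (\<Sum>B\<in>\<P>. cscale (c B) (block_state B)) w"
      proof (cases "w \<in> \<Union>\<P>")
        case True
        then obtain A where "A \<in> \<P>" "w \<in> A" by blast
        then show ?thesis
          using sum_block_state[of A w c] c[of A w] by (simp add: sum_fun_apply cscale_def)
      next
        case False
        then show ?thesis
          using block_codeD(1)[OF \<psi>] by (auto simp: sum_fun_apply cscale_def block_state_def)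
      qed
    qed
    then show "\<psi> \<in> cvs.span (block_state ` \<P>)"
      by (metis (no_types, lifting) cvs.span_base cvs.span_scale cvs.span_sum imageI)
  qed
qed

text \<open>Code vectors are constant on each block, so one representative stands for the whole
  block. Below, \<open>h\<close> is either the diagonal amplitude of an error or the constant
  1.\<close>

lemma sum_over_code:
  assumes "\<phi> \<in> block_code" "\<psi> \<in> block_code"
  shows "(\<Sum>w\<in>words Q N. cnj (\<phi> w) * \<psi> w * h w) =
    (\<Sum>A\<in>\<P>. cnj (\<phi> (SOME x. x \<in> A)) * \<psi> (SOME x. x \<in> A) * (\<Sum>x\<in>A. h x))"
proof -
  have "(\<Sum>w\<in>words Q N. cnj (\<phi> w) * \<psi> w * h w) = (\<Sum>w\<in>\<Union>\<P>. cnj (\<phi> w) * \<psi> w * h w)"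
    using block_codeD(1)[OF assms(1)] Union_subset finite_words
    by (intro sum.mono_neutral_right) auto
  also have "\<dots> = (\<Sum>A\<in>\<P>. \<Sum>x\<in>A. cnj (\<phi> x) * \<psi> x * h x)"
    using finite_block disjoint by (subst sum.Union_disjoint) auto
  also have "\<dots> = (\<Sum>A\<in>\<P>. cnj (\<phi> (SOME x. x \<in> A)) * \<psi> (SOME x. x \<in> A) * (\<Sum>x\<in>A. h x))"
  proof (rule sum.cong[OF refl])
    fix A assume A: "A \<in> \<P>"
    have "\<phi> x = \<phi> (SOME x. x \<in> A) \<and> \<psi> x = \<psi> (SOME x. x \<in> A)" if "x \<in> A" for x
      using block_codeD(2)[OF assms(1) A that] block_codeD(2)[OF assms(2) A that]
        someI[of "\<lambda>y. y \<in> A", OF that] by blast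
    then show "(\<Sum>x\<in>A. cnj (\<phi> x) * \<psi> x * h x) =
      cnj (\<phi> (SOME x. x \<in> A)) * \<psi> (SOME x. x \<in> A) * (\<Sum>x\<in>A. h x)"
      by (simp add: sum_distrib_left)
  qed
  finally show ?thesis .
qed

text \<open>
  A light error cannot map one word to another one, and on the diagonal it only sees the marginal
  distribution on its support, which is the same for all blocks.
\<close>
lemma detectable_block_code:
  assumes "error_weight Q N E < d"
  shows "detectable Q N block_code E"
proof -
  define T where "T = {i. i < N \<and> (\<exists>a<Q. \<exists>b<Q. E i a b \<noteq> (if a = b then 1 else 0))}"
  have T: "T \<subseteq> {..<N}" "card T < d"
    using assms by (auto simp: T_def error_weight_def)
  define amp where "amp x y = (\<Prod>i<N. E i (x i) (y i))" for x y
  define \<kappa> where "\<kappa> v = (\<Prod>i\<in>T. E i (v i) (v i))" for v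
  have bnd: "x i < Q" if "x \<in> words Q N" "i < N" for x i
    using that by (auto simp: words_def)
  have amp_off: "amp x y = 0" if "x \<in> \<Union>\<P>" "y \<in> \<Union>\<P>" "x \<noteq> y" for x y
  proof -
    \<comment> \<open>Since \<open>T\<close> has fewer than \<open>d\<close> positions, two distinct
      words differ at some position off \<open>T\<close>; there the error acts as the identity and
      contributes a factor 0.\<close>
    have "\<not> {i. i < N \<and> x i \<noteq> y i} \<subseteq> T"
      using separated[OF that] T card_mono[of T "{i. i < N \<and> x i \<noteq> y i}"]
      by (meson finite_lessThan finite_subset leD le_less_trans)
    then obtain i where "i < N" "x i \<noteq> y i" "i \<notin> T" by blast
    moreover have "x i < Q" "y i < Q"
      using bnd[OF _ \<open>i < N\<close>] Union_subset that(1,2) by blast+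
    ultimately have "E i (x i) (y i) = 0"
      unfolding T_def by auto
    then show ?thesis
      using \<open>i < N\<close> unfolding amp_def by (intro prod_zero) auto
  qed
  have amp_diag: "amp x x = \<kappa> (restrict x T)" if "x \<in> words Q N" for x
  proof -
    have "amp x x = (\<Prod>i\<in>T. E i (x i) (x i))"
      unfolding amp_def using T bnd[OF that]
      by (intro prod.mono_neutral_right) (auto simp: T_def)
    then show ?thesis by (simp add: \<kappa>_def)
  qed
  obtain A0 where A0: "A0 \<in> \<P>"
    using card_blocks by (metis card.empty ex_in_conv not_less_zero)
  define K where "K A = (\<Sum>x\<in>A. \<kappa> (restrict x T))" for A
  have K: "K A = K A0" if "A \<in> \<P>" for A
  proof -
    have K': "K B = (\<Sum>v\<in>T \<rightarrow>\<^sub>E {..<Q}. of_nat (card {x\<in>B. restrict x T = v}) * \<kappa> v)" if "B \<in> \<P>" for B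
    proof -
      have "restrict x T \<in> T \<rightarrow>\<^sub>E {..<Q}" if "x \<in> B" for x
        using that bnd blocks(1)[OF \<open>B \<in> \<P>\<close>] T(1) by auto
      then have "K B = (\<Sum>v\<in>T \<rightarrow>\<^sub>E {..<Q}. \<Sum>x\<in>{x\<in>B. restrict x T = v}. \<kappa> (restrict x T))"
        unfolding K_def using finite_block[OF that] T(1)
        by (intro sum.group[symmetric] finite_PiE) (blast intro: finite_subset)+
      then show ?thesis by simp
    qed
    show ?thesis
      unfolding K'[OF that] K'[OF A0] using marginals[OF T that A0] by simp
  qed
  \<comment> \<open>For the empty set of positions all words have the same restriction, so
    \<open>marginals\<close> says that all blocks have equal size.\<close>
  have cardA: "card A = card A0" if "A \<in> \<P>" for A
    using marginals[of "{}" A A0 "\<lambda>_. undefined"] d_pos that A0 by (simp add: restrict_def)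
  have A0_pos: "card A0 > 0"
    using A0 blocks(2) finite_block by (simp add: card_gt_0_iff)
  show ?thesis
    unfolding detectable_def
  \<comment> \<open>The Knill-Laflamme constant is the average diagonal amplitude over a
    block.\<close>
  proof (intro exI[of _ "K A0 / of_nat (card A0)"] ballI)
    fix \<phi> \<psi> assume in_code: "\<phi> \<in> block_code" "\<psi> \<in> block_code"
    have app: "apply_error Q N E \<psi> w = amp w w * \<psi> w" if "w \<in> \<Union>\<P>" for w
    proof -
      have "apply_error Q N E \<psi> w = (\<Sum>y\<in>words Q N. amp w y * \<psi> y)"
        using that Union_subset by (auto simp: apply_error_def amp_def)
      also have "\<dots> = (\<Sum>y\<in>words Q N. if y = w then amp w w * \<psi> w else 0)"
      proof (rule sum.cong[OF refl])
        fix y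
        show "amp w y * \<psi> y = (if y = w then amp w w * \<psi> w else 0)"
          using that amp_off[OF that, of y] block_codeD(1)[OF in_code(2), of y]
          by (cases "y = w"; cases "y \<in> \<Union>\<P>") auto
      qed
      also have "\<dots> = amp w w * \<psi> w"
        using that Union_subset finite_words by auto
      finally show ?thesis .
    qed
    define pr where "pr A = cnj (\<phi> (SOME x. x \<in> A)) * \<psi> (SOME x. x \<in> A)" for A
    have "braket Q N \<phi> (apply_error Q N E \<psi>) =
        (\<Sum>w\<in>words Q N. cnj (\<phi> w) * \<psi> w * \<kappa> (restrict w T))"
      unfolding braket_def
    proof (rule sum.cong[OF refl])
      fix w assume "w \<in> words Q N"
      then show "cnj (\<phi> w) * apply_error Q N E \<psi> w = cnj (\<phi> w) * \<psi> w * \<kappa> (restrict w T)"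
        using app[of w] amp_diag[of w] block_codeD(1)[OF in_code(1), of w]
        by (cases "w \<in> \<Union>\<P>") simp_all
    qed
    also have "\<dots> = (\<Sum>A\<in>\<P>. pr A * K A0)"
      using K by (simp add: sum_over_code[OF in_code] K_def pr_def cong: sum.cong)
    also have "\<dots> = K A0 / of_nat (card A0) * (\<Sum>A\<in>\<P>. pr A * of_nat (card A0))"
      using A0_pos by (simp flip: sum_distrib_right)
    also have "(\<Sum>A\<in>\<P>. pr A * of_nat (card A0)) = braket Q N \<phi> \<psi>"
      using sum_over_code[OF in_code, of "\<lambda>_. 1"] cardA by (simp add: braket_def pr_def cong: sum.cong)
    finally show "braket Q N \<phi> (apply_error Q N E \<psi>) = K A0 / of_nat (card A0) * braket Q N \<phi> \<psi>" .
  qed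
qed

text \<open>For \<open>x\<close> and \<open>y\<close> in different blocks, |x><y| has matrix element
  1 between two block states that are orthogonal, so no constant \<open>c\<close> can work.\<close>

lemma ex_undetectable: "\<exists>E. \<not> detectable Q N block_code E"
proof -
  obtain A B where XY: "A \<in> \<P>" "B \<in> \<P>" "A \<noteq> B"
    using card_blocks by (metis One_nat_def card_le_Suc0_iff_eq finite_blocks not_le)
  obtain x y where xy: "x \<in> A" "y \<in> B"
    using XY blocks(2) by blast
  have words: "x \<in> words Q N" "y \<in> words Q N"
    using XY xy blocks(1) by blast+
  define E :: product_error where "E i a b = (if a = x i \<and> b = y i then 1 else 0)" for i a b
  have app: "apply_error Q N E (block_state B) w = (if w = x then 1 else 0)"
    if "w \<in> words Q N" for w
  proof -
    have "apply_error Q N E (block_state B) w =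
      (\<Sum>y'\<in>words Q N. if y' = y then (if w = x then 1 else 0) else 0)"
      unfolding apply_error_def using that words xy
      by (auto intro!: sum.cong simp: E_def amplitude_matrix_unit block_state_def)
    also have "\<dots> = (if w = x then 1 else 0)"
      using words finite_words by simp
    finally show ?thesis .
  qed
  have "braket Q N (block_state A) (apply_error Q N E (block_state B)) =
      (\<Sum>w\<in>words Q N. if w = x then 1 else 0)"
    unfolding braket_def using app xy by (intro sum.cong) (auto simp: block_state_def)
  also have "\<dots> = 1"
    using words finite_words by simp
  finally have 1: "braket Q N (block_state A) (apply_error Q N E (block_state B)) = 1" .
  have "braket Q N (block_state A) (block_state B) = 0"
    unfolding braket_def using disjoint[OF XY] by (intro sum.neutral) (auto simp: block_state_def)
  with 1 have "\<not> detectable Q N block_code E"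
    unfolding detectable_def using block_state_in[OF XY(1)] block_state_in[OF XY(2)] by force
  then show ?thesis by blast
qed

text \<open>The minimum distance is the least weight of an undetectable error;
  \<open>detectable_block_code\<close> keeps it from falling below \<open>d\<close>.\<close>

theorem ex_quantum_code: "\<exists>D V. quantum_code Q N k D V \<and> D \<ge> d"
proof -
  define P where "P w \<longleftrightarrow> (\<exists>E. error_weight Q N E = w \<and> \<not> detectable Q N block_code E)" for w
  define D where "D = (LEAST w. P w)"
  have "P D"
    unfolding D_def using ex_undetectable LeastI_ex[of P] unfolding P_def by blast
  moreover have "detectable Q N block_code E" if "error_weight Q N E < D" for E
    using not_less_Least[of "error_weight Q N E" P] that unfolding D_def P_def by blast
  ultimately have "has_min_distance Q N block_code D"
    unfolding has_min_distance_def P_def by blast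
  moreover have "D \<ge> d"
    using \<open>P D\<close> detectable_block_code unfolding P_def by (metis not_le)
  moreover have "block_code \<subseteq> state_space Q N"
    using Union_subset unfolding block_code_def state_space_def by blast
  ultimately show ?thesis
    unfolding quantum_code_def using subspace_block_code dim_block_code by blast
qed

end

text \<open>The blocks are the cosets \<open>r + C1\<close> for \<open>r\<close> in the transversal
  \<open>R\<close>, with field elements recoded as digits. For linear codes, \<open>surj\<close>
  says that nonzero words of the dual of \<open>C1\<close> have weight at least \<open>d\<close>;
  stating it as interpolation avoids duals. \<open>supp\<close> makes the recoding injective on
  \<open>C2\<close>.\<close>

lemma css_construction:
  fixes C1 C2 R :: "(nat \<Rightarrow> 'a::{finite,ab_group_add}) set"
  assumes C1: "\<And>x y. x \<in> C1 \<Longrightarrow> y \<in> C1 \<Longrightarrow> x - y \<in> C1" "C1 \<noteq> {}" "C1 \<subseteq> C2"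
    and C2: "\<And>x y. x \<in> C2 \<Longrightarrow> y \<in> C2 \<Longrightarrow> x - y \<in> C2"
    and supp: "\<And>x i. x \<in> C2 \<Longrightarrow> i \<ge> N \<Longrightarrow> x i = 0"
    and R: "R \<subseteq> C2" "card R = CARD('a) ^ k" "CARD('a) ^ k > 1"
      "\<And>x y. x \<in> R \<Longrightarrow> y \<in> R \<Longrightarrow> x - y \<in> C1 \<Longrightarrow> x = y"
    and d: "d > 0"
    and weight: "\<And>x. x \<in> C2 \<Longrightarrow> x \<noteq> 0 \<Longrightarrow> d \<le> card {i. i < N \<and> x i \<noteq> 0}"
    and surj: "\<And>T f. T \<subseteq> {..<N} \<Longrightarrow> card T < d \<Longrightarrow> \<exists>c\<in>C1. \<forall>i\<in>T. c i = f i"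
  shows "\<exists>D V. quantum_code CARD('a) N k D V \<and> D \<ge> d"
proof -
  define Q where "Q = CARD('a)"
  obtain h :: "'a \<Rightarrow> nat" where h: "bij_betw h UNIV {..<Q}"
    using ex_bij_betw_finite_nat[of "UNIV :: 'a set"] by (auto simp: Q_def atLeast0LessThan)
  have h_inj: "h a = h b \<longleftrightarrow> a = b" for a b
    using h by (meson bij_betw_def injD)
  define enc where "enc f = restrict (\<lambda>i. h (f i)) {..<N}" for f
  have enc_word: "enc f \<in> words Q N" for f
    unfolding enc_def words_def using h by (auto simp: bij_betw_def)
  have zero: "0 \<in> C1"
    using C1(1,2) by (metis diff_self ex_in_conv)
  have plus: "x + y \<in> C1" if "x \<in> C1" "y \<in> C1" for x y
    using C1(1)[OF that(1) C1(1)[OF zero that(2)]] by simp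
  have plus2: "x + y \<in> C2" if "x \<in> C2" "y \<in> C2" for x y
    using C2[OF that(1) C2[OF _ that(2)], of 0] zero C1(3) by auto
  have enc_inj: "x = y" if "enc x = enc y" "x \<in> C2" "y \<in> C2" for x y
  proof
    fix i show "x i = y i"
      using fun_cong[OF that(1), of i] supp[OF that(2), of i] supp[OF that(3), of i]
      by (cases "i < N") (auto simp: enc_def h_inj)
  qed
  define blk where "blk r = enc ` (\<lambda>c. r + c) ` C1" for r
  have in_C2: "r + c \<in> C2" if "r \<in> R" "c \<in> C1" for r c
    using that plus2 R(1) C1(3) by blast
  have meet: "r = r'" if rr: "r \<in> R" "r' \<in> R" "w \<in> blk r" "w \<in> blk r'" for r r' w
  proof -
    obtain c c' where c: "c \<in> C1" "c' \<in> C1" "w = enc (r + c)" "w = enc (r' + c')"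
      using rr unfolding blk_def by blast
    then have "r + c = r' + c'"
      using enc_inj in_C2 that by metis
    then have "r - r' = c' - c"
      by (simp add: algebra_simps)
    then show ?thesis
      using R(4) that C1(1) c by metis
  qed
  have blk_ne: "blk r \<noteq> {}" for r
    using C1(2) by (simp add: blk_def)
  have "inj_on blk R"
    using meet blk_ne by (metis ex_in_conv inj_onI)
  interpret word_partition Q N k d "blk ` R"
  proof
    fix A assume "A \<in> blk ` R"
    then show "A \<subseteq> words Q N" "A \<noteq> {}"
      using enc_word blk_ne by (auto simp: blk_def)
  next
    fix A B assume "A \<in> blk ` R" "B \<in> blk ` R" "A \<noteq> B"
    then show "A \<inter> B = {}"
      using meet by blast
  next
    show "card (blk ` R) = Q ^ k"
      using \<open>inj_on blk R\<close> R(2) by (simp add: card_image Q_def)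
    show "Q ^ k > 1" "d > 0"
      using R(3) d by (simp_all add: Q_def)
  next
    fix x y assume xy: "x \<in> \<Union>(blk ` R)" "y \<in> \<Union>(blk ` R)" "x \<noteq> y"
    then obtain f g where fg: "f \<in> C2" "g \<in> C2" "x = enc f" "y = enc g"
      using in_C2 by (auto simp: blk_def)
    have "{i. i < N \<and> x i \<noteq> y i} = {i. i < N \<and> (f - g) i \<noteq> 0}"
      using fg by (auto simp: enc_def h_inj)
    moreover have "f - g \<noteq> 0"
      using fg xy(3) by auto
    ultimately show "d \<le> card {i. i < N \<and> x i \<noteq> y i}"
      using weight[OF C2[OF fg(1,2)]] by simp
  next
    fix T A B v assume T: "T \<subseteq> {..<N}" "card T < d" and "A \<in> blk ` R" "B \<in> blk ` R"
    then obtain r s where rs: "r \<in> R" "s \<in> R" "A = blk r" "B = blk s" by blast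
    \<comment> \<open>Choose \<open>c0\<close> in \<open>C1\<close> agreeing with
      \<open>r - s\<close> on \<open>T\<close>. Then \<open>c\<close> maps to \<open>c + c0\<close>,
      an injection that preserves the pattern on \<open>T\<close>, because \<open>s + c + c0\<close>
      and \<open>r + c\<close> agree there. Exchanging \<open>r\<close> and \<open>s\<close> gives
      equality.\<close>
    have le: "card {x \<in> blk r. restrict x T = v} \<le> card {x \<in> blk s. restrict x T = v}"
      if rs: "r \<in> R" "s \<in> R" for r s
    proof -
      obtain c0 where c0: "c0 \<in> C1" "\<And>i. i \<in> T \<Longrightarrow> c0 i = (r - s) i"
        using surj[OF T, of "r - s"] by blast
      have card_eq: "card {x \<in> blk r. restrict x T = v} =
          card {c \<in> C1. restrict (enc (r + c)) T = v}" if "r \<in> R" for r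
      proof -
        have inj: "inj_on (\<lambda>c. enc (r + c)) {c \<in> C1. restrict (enc (r + c)) T = v}"
          using enc_inj in_C2 that by (intro inj_onI) (metis (no_types, lifting) add_left_cancel mem_Collect_eq)
        have img: "(\<lambda>c. enc (r + c)) ` {c \<in> C1. restrict (enc (r + c)) T = v} =
            {x \<in> blk r. restrict x T = v}"
          by (auto simp: blk_def)
        show ?thesis
          using card_image[OF inj] unfolding img .
      qed
      have "card {c \<in> C1. restrict (enc (r + c)) T = v} \<le>
          card {c \<in> C1. restrict (enc (s + c)) T = v}"
      proof (rule card_inj_on_le[where f = "\<lambda>c. c + c0"])
        show "inj_on (\<lambda>c. c + c0) {c \<in> C1. restrict (enc (r + c)) T = v}"
          by simp
        have "restrict (enc (s + (c + c0))) T = restrict (enc (r + c)) T" for c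
        proof (rule restrict_ext)
          fix i assume "i \<in> T"
          then have "(s + (c + c0)) i = (r + c) i"
            using c0(2)[of i] by (simp add: algebra_simps)
          then show "enc (s + (c + c0)) i = enc (r + c) i"
            by (simp add: enc_def del: plus_fun_apply)
        qed
        then show "(\<lambda>c. c + c0) ` {c \<in> C1. restrict (enc (r + c)) T = v} \<subseteq>
            {c \<in> C1. restrict (enc (s + c)) T = v}"
          using plus c0(1) by auto
        have "inj_on (\<lambda>c. enc (s + c)) {c \<in> C1. restrict (enc (s + c)) T = v}"
          using enc_inj in_C2 rs(2) by (intro inj_onI) (metis (no_types, lifting) add_left_cancel mem_Collect_eq)
        moreover have "finite ((\<lambda>c. enc (s + c)) ` {c \<in> C1. restrict (enc (s + c)) T = v})"
          using enc_word finite_words by (meson finite_subset image_subsetI)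
        ultimately show "finite {c \<in> C1. restrict (enc (s + c)) T = v}"
          by (rule finite_imageD[rotated])
      qed
      then show ?thesis
        using card_eq rs by simp
    qed
    show "card {x \<in> A. restrict x T = v} = card {x \<in> B. restrict x T = v}"
      using le[of r s] le[of s r] rs by simp
  qed
  show ?thesis
    using ex_quantum_code by (simp add: Q_def)
qed

section \<open>Evaluation codes from a semigroup of pole orders\<close>

definition fscale :: "'a::field \<Rightarrow> ('p \<Rightarrow> 'a) \<Rightarrow> 'p \<Rightarrow> 'a" where
  "fscale c f = (\<lambda>x. c * f x)"

global_interpretation fvs: vector_space fscale
  by unfold_locales (auto simp: fscale_def fun_eq_iff algebra_simps)

definition restr :: "'p set \<Rightarrow> ('p \<Rightarrow> 'a::zero) \<Rightarrow> 'p \<Rightarrow> 'a" where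
  "restr T f = (\<lambda>x. if x \<in> T then f x else 0)"

lemma span_restr: "fvs.span (restr T ` B) = restr T ` fvs.span B"
proof -
  have "module_hom fscale fscale (restr T)"
    by unfold_locales (auto simp: fscale_def restr_def fun_eq_iff algebra_simps)
  then show ?thesis
    by (rule module_hom.span_image)
qed

definition point_fun :: "'p \<Rightarrow> 'p \<Rightarrow> 'a::field" where
  "point_fun p = (\<lambda>x. if x = p then 1 else 0)"

lemma restr_in_span_point_funs:
  assumes "finite T"
  shows "restr T f \<in> fvs.span (point_fun ` T)"
proof -
  have "restr T f = (\<Sum>p\<in>T. fscale (f p) (point_fun p))"
    using assms by (auto simp: restr_def fun_eq_iff sum_fun_apply fscale_def point_fun_def
      if_distrib cong: if_cong)
  then show ?thesis
    by (metis (no_types, lifting) fvs.span_base fvs.span_scale fvs.span_sum imageI)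
qed

lemma inj_point_fun: "inj_on (point_fun :: 'p \<Rightarrow> 'p \<Rightarrow> 'a::field) T"
  by (rule inj_onI) (metis point_fun_def zero_neq_one)

lemma independent_point_funs:
  assumes "finite T"
  shows "fvs.independent (point_fun ` T :: ('p \<Rightarrow> 'a::field) set)"
proof (rule fvs.independent_if_scalars_zero)
  show "finite (point_fun ` T :: ('p \<Rightarrow> 'a) set)"
    using assms by simp
next
  fix c :: "('p \<Rightarrow> 'a) \<Rightarrow> 'a" and f :: "'p \<Rightarrow> 'a"
  assume 0: "(\<Sum>f\<in>point_fun ` T. fscale (c f) f) = 0" and "f \<in> point_fun ` T"
  then obtain p where p: "p \<in> T" "f = point_fun p" by blast
  have "0 = (\<Sum>p\<in>T. fscale (c (point_fun p)) (point_fun p)) p"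
    using 0 by (simp add: sum.reindex[OF inj_point_fun])
  also have "\<dots> = (\<Sum>q\<in>T. if q = p then c f else 0)"
    using p(2) by (auto simp: sum_fun_apply fscale_def point_fun_def intro!: sum.cong)
  also have "\<dots> = c f"
    using p(1) assms by simp
  finally show "c f = 0" by simp
qed

text \<open>Distinct elements of the difference lie in distinct classes mod \<open>r\<close>:
  otherwise the larger one is the smaller plus a positive multiple of \<open>r\<close>, and
  splitting off one \<open>r\<close> puts it in the translate. For \<open>r = 0\<close> the
  difference is empty.\<close>

lemma card_semigroup_minus_translate:
  assumes add: "\<And>u v. u \<in> S \<Longrightarrow> v \<in> S \<Longrightarrow> u + v \<in> S" and r: "r \<in> S"
  shows "finite (S - (+) r ` S) \<and> card (S - (+) r ` S) \<le> (r::nat)"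
proof (cases "r = 0")
  case False
  have "u = v" if uv: "u \<in> S - (+) r ` S" "v \<in> S - (+) r ` S" "u mod r = v mod r" for u v
  proof -
    have less: False if uv: "u \<in> S - (+) r ` S" "v \<in> S - (+) r ` S" "u mod r = v mod r" "u < v" for u v
    proof -
      obtain k where k: "v = u + r * k"
        using uv(3,4) by (metis less_imp_le mod_eq_dvd_iff_nat dvdE le_add_diff_inverse)
      then obtain k' where k': "k = Suc k'"
        using uv(4) by (cases k) auto
      have "u + r * j \<in> S" for j
      proof (induction j)
        case (Suc j)
        from add[OF this r] show ?case by (simp add: algebra_simps)
      qed (use uv(1) in simp)
      then have "v \<in> (+) r ` S"
        using k k' by (auto simp: algebra_simps image_iff intro!: bexI[of _ "u + r * k'"])
      with uv(2) show False by blast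
    qed
    show ?thesis
      using less[OF uv] less[OF uv(2,1) uv(3)[symmetric]] by (metis nat_neq_iff)
  qed
  then have inj: "inj_on (\<lambda>u. u mod r) (S - (+) r ` S)"
    by (intro inj_onI) blast
  have img: "(\<lambda>u. u mod r) ` (S - (+) r ` S) \<subseteq> {..<r}"
    using False by auto
  then have "finite (S - (+) r ` S)"
    using inj finite_imageD finite_subset by blast
  then show ?thesis
    using card_inj_on_le[OF inj img] by simp
qed (auto simp: image_iff)

text \<open>
  Functions on a finite set of points, filtered by pole order: \<open>S\<close> is the semigroup of pole orders
  and \<open>e r\<close> is a function of pole order \<open>r\<close>. Below, \<open>L r\<close> bounds pole orders strictly.
\<close>
locale eval_filtration =
  fixes S :: "nat set" and e :: "nat \<Rightarrow> 'p \<Rightarrow> 'a::field" and I :: "'p set" and g :: nat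
  assumes S_add: "u \<in> S \<Longrightarrow> v \<in> S \<Longrightarrow> u + v \<in> S"
    and gaps: "finite (- S)" "card (- S) \<le> g"
    and finite_I: "finite I"
    and e_mult: "u \<in> S \<Longrightarrow> v \<in> S \<Longrightarrow> e u * e v - e (u + v) \<in> fvs.span (e ` {t \<in> S. t < u + v})"
    and interpolation: "\<exists>r. \<exists>h \<in> fvs.span (e ` {t \<in> S. t < r}). \<forall>x\<in>I. h x = f x"
begin

definition L :: "nat \<Rightarrow> ('p \<Rightarrow> 'a) set" where
  "L r = fvs.span (e ` {t \<in> S. t < r})"

text \<open>The orders that are new on \<open>T\<close>: the complement of the orders of functions vanishing on \<open>T\<close>.\<close>
definition delta :: "'p set \<Rightarrow> nat set" where
  "delta T = {r \<in> S. \<forall>h\<in>L r. \<exists>x\<in>T. e r x \<noteq> h x}"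

section \<open>The filtration by pole order and the orders that are new on a set of points\<close>

lemma L_mono: "r \<le> s \<Longrightarrow> L r \<subseteq> L s"
  unfolding L_def by (intro fvs.span_mono) auto

lemma e_in_L: "r \<in> S \<Longrightarrow> r < s \<Longrightarrow> e r \<in> L s"
  unfolding L_def by (intro fvs.span_base) auto

lemma L_add: "f \<in> L r \<Longrightarrow> h \<in> L r \<Longrightarrow> f + h \<in> L r"
  unfolding L_def by (rule fvs.span_add)

lemma L_diff: "f \<in> L r \<Longrightarrow> h \<in> L r \<Longrightarrow> f - h \<in> L r"
  unfolding L_def by (rule fvs.span_diff)

lemma L_scale: "f \<in> L r \<Longrightarrow> fscale c f \<in> L r"
  unfolding L_def by (rule fvs.span_scale)

lemma L_Suc: "h \<in> L (Suc r) \<Longrightarrow> (r \<in> S \<and> (\<exists>c. h - fscale c (e r) \<in> L r)) \<or> h \<in> L r"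
proof -
  assume h: "h \<in> L (Suc r)"
  show ?thesis
  proof (cases "r \<in> S")
    case True
    then have "e ` {t \<in> S. t < Suc r} = insert (e r) (e ` {t \<in> S. t < r})"
      by (auto simp: less_Suc_eq)
    then show ?thesis
      using h True unfolding L_def by (metis fvs.span_breakdown_eq)
  next
    case False
    then have "{t \<in> S. t < Suc r} = {t \<in> S. t < r}"
      by (auto simp: less_Suc_eq)
    then show ?thesis
      using h by (simp add: L_def)
  qed
qed

lemma L_mult:
  assumes "h \<in> L u" "v \<in> S"
  shows "h * e v \<in> L (u + v)"
proof -
  have "fvs.subspace {h. h * e v \<in> L (u + v)}"
  proof (rule fvs.subspaceI)
    show "0 \<in> {h. h * e v \<in> L (u + v)}"
      by (simp add: L_def fvs.span_zero)
  next
    fix f h assume "f \<in> {h. h * e v \<in> L (u + v)}" "h \<in> {h. h * e v \<in> L (u + v)}"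
    then show "f + h \<in> {h. h * e v \<in> L (u + v)}"
      by (simp add: L_add distrib_right)
  next
    fix c h assume "h \<in> {h. h * e v \<in> L (u + v)}"
    moreover have "fscale c h * e v = fscale c (h * e v)"
      by (simp add: fscale_def fun_eq_iff)
    ultimately show "fscale c h \<in> {h. h * e v \<in> L (u + v)}"
      by (simp add: L_scale)
  qed
  moreover have "e ` {t \<in> S. t < u} \<subseteq> {h. h * e v \<in> L (u + v)}"
  proof safe
    fix t assume t: "t \<in> S" "t < u"
    have "e t * e v - e (t + v) \<in> L (u + v)"
      using e_mult[OF t(1) assms(2)] L_mono[of "t + v" "u + v"] t(2) by (auto simp: L_def)
    moreover have "e (t + v) \<in> L (u + v)"
      using t S_add assms(2) by (intro e_in_L) auto
    ultimately show "e t * e v \<in> L (u + v)"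
      using L_add by fastforce
  qed
  ultimately have "L u \<subseteq> {h. h * e v \<in> L (u + v)}"
    unfolding L_def by (rule fvs.span_minimal[rotated])
  then show ?thesis
    using assms(1) by blast
qed

text \<open>If \<open>e u\<close> agrees on \<open>T\<close> with a function of lower order,
  multiplying by \<open>e v\<close> gives the same for \<open>e (u + v)\<close>, up to the
  lower-order error in \<open>e_mult\<close>.\<close>

lemma delta_summand:
  assumes "u \<in> S" "v \<in> S" "u + v \<in> delta T"
  shows "u \<in> delta T"
proof (rule ccontr)
  assume "u \<notin> delta T"
  then obtain h where h: "h \<in> L u" "\<And>x. x \<in> T \<Longrightarrow> e u x = h x"
    using assms(1) unfolding delta_def by blast
  have "h * e v - (e u * e v - e (u + v)) \<in> L (u + v)"
    using L_mult[OF h(1) assms(2)] e_mult[OF assms(1,2)] by (auto simp: L_def intro: fvs.span_diff)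
  moreover have "e (u + v) x = (h * e v - (e u * e v - e (u + v))) x" if "x \<in> T" for x
    using h(2)[OF that] by simp
  ultimately show False
    using assms(3) unfolding delta_def by blast
qed

text \<open>On \<open>T\<close>, each \<open>e r\<close> with \<open>r\<close> not in
  \<open>delta T\<close> can be replaced by a function of lower order; induction on the order leaves
  only generators from \<open>delta T\<close>.\<close>

lemma L_eq_on_delta:
  "h \<in> L r \<Longrightarrow> \<exists>h' \<in> fvs.span (e ` {t \<in> delta T. t < r}). \<forall>x\<in>T. h x = h' x"
proof (induction r arbitrary: h)
  case 0
  then show ?case by (auto simp: L_def)
next
  case (Suc r)
  let ?D = "\<lambda>r. fvs.span (e ` {t \<in> delta T. t < r})"
  have sub: "?D r \<subseteq> ?D (Suc r)"
    by (intro fvs.span_mono) auto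
  have low: "\<exists>h' \<in> ?D (Suc r). \<forall>x\<in>T. f x = h' x" if "f \<in> L r" for f
    using Suc.IH[OF that] sub by blast
  from L_Suc[OF Suc.prems] show ?case
  proof
    assume "h \<in> L r"
    then show ?thesis by (rule low)
  next
    assume "r \<in> S \<and> (\<exists>c. h - fscale c (e r) \<in> L r)"
    then obtain c where c: "r \<in> S" "h - fscale c (e r) \<in> L r" by blast
    obtain f where f: "f \<in> ?D (Suc r)" "\<And>x. x \<in> T \<Longrightarrow> (h - fscale c (e r)) x = f x"
      using low[OF c(2)] by blast
    have "\<exists>f' \<in> ?D (Suc r). \<forall>x\<in>T. e r x = f' x"
    proof (cases "r \<in> delta T")
      case True
      then show ?thesis by (intro bexI[of _ "e r"] fvs.span_base) auto
    next
      case False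
      then obtain k where "k \<in> L r" "\<forall>x\<in>T. e r x = k x"
        using c(1) unfolding delta_def by blast
      then show ?thesis
        using low by metis
    qed
    then obtain f' where f': "f' \<in> ?D (Suc r)" "\<And>x. x \<in> T \<Longrightarrow> e r x = f' x"
      by blast
    have "f + fscale c f' \<in> ?D (Suc r)"
      using f f' by (intro fvs.span_add fvs.span_scale)
    moreover have "h x = (f + fscale c f') x" if "x \<in> T" for x
      using f(2)[OF that] f'(2)[OF that] by (simp add: fscale_def algebra_simps)
    ultimately show ?thesis by blast
  qed
qed

lemma delta_interpolation:
  assumes "T \<subseteq> I"
  shows "\<exists>h \<in> fvs.span (e ` delta T). \<forall>x\<in>T. h x = f x"
proof -
  obtain r h where "h \<in> L r" "\<forall>x\<in>I. h x = f x"
    using interpolation[of f] by (auto simp: L_def)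
  then obtain h' where "h' \<in> fvs.span (e ` {t \<in> delta T. t < r})" "\<forall>x\<in>T. h' x = f x"
    using L_eq_on_delta[of h r T] assms by (metis subsetD)
  moreover have "fvs.span (e ` {t \<in> delta T. t < r}) \<subseteq> fvs.span (e ` delta T)"
    by (intro fvs.span_mono) auto
  ultimately show ?thesis by blast
qed

lemma restr_e_notin_span:
  assumes "r \<in> delta T"
  shows "restr T (e r) \<notin> fvs.span (restr T ` e ` {t \<in> delta T. t < r})"
proof
  assume "restr T (e r) \<in> fvs.span (restr T ` e ` {t \<in> delta T. t < r})"
  then obtain h where h: "h \<in> fvs.span (e ` {t \<in> delta T. t < r})" "restr T (e r) = restr T h"
    unfolding span_restr by blast
  moreover have "fvs.span (e ` {t \<in> delta T. t < r}) \<subseteq> L r"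
    unfolding L_def delta_def by (intro fvs.span_mono) auto
  moreover have "e r x = h x" if "x \<in> T" for x
    using fun_cong[OF h(2), of x] that by (simp add: restr_def)
  ultimately show False
    using assms unfolding delta_def by blast
qed

text \<open>A triangular argument: by the definition of \<open>delta\<close>, each new generator
  lies outside the span of the earlier ones after restriction to \<open>T\<close>.\<close>

lemma independent_delta:
  "inj_on (restr T \<circ> e) {t \<in> delta T. t < n} \<and>
   fvs.independent (restr T ` e ` {t \<in> delta T. t < n})"
proof (induction n)
  case (Suc n)
  show ?case
  proof (cases "n \<in> delta T")
    case True
    then have *: "{t \<in> delta T. t < Suc n} = insert n {t \<in> delta T. t < n}"
      by (auto simp: less_Suc_eq)
    have "restr T (e n) \<notin> restr T ` e ` {t \<in> delta T. t < n}"
      using restr_e_notin_span[OF True] fvs.span_superset[of "restr T ` e ` {t \<in> delta T. t < n}"]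
      by (meson subsetD)
    then show ?thesis
      unfolding * using Suc restr_e_notin_span[OF True]
      by (auto simp: fvs.independent_insert image_comp)
  next
    case False
    then have "{t \<in> delta T. t < Suc n} = {t \<in> delta T. t < n}"
      by (auto simp: less_Suc_eq)
    then show ?thesis
      using Suc by simp
  qed
qed (simp add: fvs.independent_empty)

text \<open>The restrictions of the \<open>e t\<close> with \<open>t\<close> in
  \<open>delta T\<close> form a basis of the functions on \<open>T\<close>. Independence bounds
  every finite part of \<open>delta T\<close> by \<open>card T\<close>, hence also gives finiteness;
  interpolation gives the converse bound.\<close>

lemma card_delta:
  assumes "T \<subseteq> I"
  shows "finite (delta T)" "card (delta T) = card T"
proof -
  have fin: "finite T"
    using assms finite_I finite_subset by blast
  have le: "card {t \<in> delta T. t < n} \<le> card T" for n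
  proof -
    have "restr T ` e ` {t \<in> delta T. t < n} \<subseteq> fvs.span (point_fun ` T)"
      using restr_in_span_point_funs[OF fin] by auto
    then have "card (restr T ` e ` {t \<in> delta T. t < n}) \<le> card (point_fun ` T :: ('p \<Rightarrow> 'a) set)"
      using fvs.independent_span_bound[of "point_fun ` T"] independent_delta[of T n] fin by blast
    moreover have "card (restr T ` e ` {t \<in> delta T. t < n}) = card {t \<in> delta T. t < n}"
      unfolding image_comp using independent_delta[of T n] by (intro card_image) simp
    ultimately show ?thesis
      using card_image_le[OF fin, of "point_fun :: 'p \<Rightarrow> 'p \<Rightarrow> 'a"] by linarith
  qed
  show finite: "finite (delta T)"
  proof (rule ccontr)
    assume "infinite (delta T)"
    then obtain B where B: "B \<subseteq> delta T" "finite B" "card B = Suc (card T)"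
      by (meson infinite_arbitrarily_large)
    then obtain n where "\<forall>t\<in>B. t < n"
      using finite_nat_set_iff_bounded by blast
    then have "B \<subseteq> {t \<in> delta T. t < n}"
      using B(1) by blast
    then have "card B \<le> card {t \<in> delta T. t < n}"
      by (intro card_mono) auto
    then show False
      using le[of n] B(3) by linarith
  qed
  obtain n where n: "\<forall>t\<in>delta T. t < n"
    using finite finite_nat_set_iff_bounded by blast
  then have "{t \<in> delta T. t < n} = delta T" by blast
  then have "card (delta T) \<le> card T"
    using le[of n] by simp
  moreover have "card T \<le> card (delta T)"
  proof -
    have "point_fun ` T \<subseteq> fvs.span (restr T ` e ` delta T)"
    proof safe
      fix p assume "p \<in> T"
      obtain h where h: "h \<in> fvs.span (e ` delta T)" "\<forall>x\<in>T. h x = point_fun p x"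
        using delta_interpolation[OF assms] by blast
      have "restr T h = point_fun p"
        using h(2) \<open>p \<in> T\<close> by (auto simp: restr_def point_fun_def)
      then show "point_fun p \<in> fvs.span (restr T ` e ` delta T)"
        unfolding span_restr using h(1) by (metis imageI)
    qed
    then have "card (point_fun ` T :: ('p \<Rightarrow> 'a) set) \<le> card (restr T ` e ` delta T)"
      using fvs.independent_span_bound[OF _ independent_point_funs[OF fin], of "restr T ` e ` delta T"]
        finite by simp
    moreover have "card (point_fun ` T :: ('p \<Rightarrow> 'a) set) = card T"
      by (rule card_image[OF inj_point_fun])
    moreover have "card (restr T ` e ` delta T) \<le> card (delta T)"
      unfolding image_comp using finite by (rule card_image_le)
    ultimately show ?thesis by linarith
  qed
  ultimately show "card (delta T) = card T" by simp
qed

text \<open>Of the \<open>r + 1\<close> candidates \<open>u\<close>, at most \<open>g\<close> are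
  gaps and at most \<open>g\<close> have a gap as \<open>r - u\<close>.\<close>

lemma decompositions_ge: "r + 1 \<le> card {u. u \<le> r \<and> u \<in> S \<and> r - u \<in> S} + 2 * g"
proof -
  have "{..r} \<subseteq> {u. u \<le> r \<and> u \<in> S \<and> r - u \<in> S} \<union> (- S \<union> (\<lambda>v. r - v) ` (- S))"
  proof
    fix u assume "u \<in> {..r}"
    then show "u \<in> {u. u \<le> r \<and> u \<in> S \<and> r - u \<in> S} \<union> (- S \<union> (\<lambda>v. r - v) ` (- S))"
      by (cases "r - u \<in> S") (auto simp: image_iff intro!: bexI[of _ "r - u"])
  qed
  then have "card {..r} \<le> card ({u. u \<le> r \<and> u \<in> S \<and> r - u \<in> S} \<union> (- S \<union> (\<lambda>v. r - v) ` (- S)))"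
    using gaps by (intro card_mono) auto
  also have "\<dots> \<le> card {u. u \<le> r \<and> u \<in> S \<and> r - u \<in> S} + (card (- S) + card ((\<lambda>v. r - v) ` (- S)))"
    using card_Un_le[of "{u. u \<le> r \<and> u \<in> S \<and> r - u \<in> S}" "- S \<union> (\<lambda>v. r - v) ` (- S)"]
      card_Un_le[of "- S" "(\<lambda>v. r - v) ` (- S)"] by linarith
  also have "\<dots> \<le> card {u. u \<le> r \<and> u \<in> S \<and> r - u \<in> S} + (g + g)"
    using gaps card_image_le[OF gaps(1), of "\<lambda>v. r - v"] by linarith
  finally show ?thesis by simp
qed

lemma in_S_if_large: "2 * g \<le> r \<Longrightarrow> r \<in> S"
proof (rule ccontr)
  assume r: "2 * g \<le> r" "r \<notin> S"
  have "{u. u \<le> r \<and> u \<in> S \<and> r - u \<in> S} \<noteq> {}"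
  proof
    assume "{u. u \<le> r \<and> u \<in> S \<and> r - u \<in> S} = {}"
    then have "card {u. u \<le> r \<and> u \<in> S \<and> r - u \<in> S} = 0"
      by (simp only: card.empty)
    then show False
      using decompositions_ge[of r] r(1) by linarith
  qed
  then obtain u where "u \<le> r" "u \<in> S" "r - u \<in> S" by blast
  then show False
    using S_add[of u "r - u"] r(2) by simp
qed

text \<open>Both parts of a decomposition of \<open>r\<close> in \<open>S\<close> lie in
  \<open>delta T\<close> by \<open>delta_summand\<close>, so there are at most \<open>card T\<close>
  decompositions.\<close>

lemma delta_upper:
  assumes "T \<subseteq> I" "r \<in> delta T"
  shows "r + 1 \<le> card T + 2 * g"
proof -
  have "{u. u \<le> r \<and> u \<in> S \<and> r - u \<in> S} \<subseteq> delta T"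
    using delta_summand assms(2) by fastforce
  then have "card {u. u \<le> r \<and> u \<in> S \<and> r - u \<in> S} \<le> card T"
    using card_delta[OF assms(1)] card_mono by metis
  then show ?thesis
    using decompositions_ge[of r] by linarith
qed

text \<open>By \<open>delta_summand\<close>, no element of \<open>r + S\<close> can lie in
  \<open>delta T\<close>, and at most \<open>r\<close> elements of \<open>S\<close> lie outside
  \<open>r + S\<close>.\<close>

lemma card_le_if_not_delta:
  assumes "T \<subseteq> I" "r \<in> S" "r \<notin> delta T"
  shows "card T \<le> r"
proof -
  have "t \<in> S" "t \<notin> (+) r ` S" if "t \<in> delta T" for t
    using that delta_summand[OF assms(2), of _ T] assms(3) by (auto simp: delta_def[of T])
  then have "delta T \<subseteq> S - (+) r ` S"
    by blast
  then have "card (delta T) \<le> card (S - (+) r ` S)"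
    using card_semigroup_minus_translate[OF S_add assms(2)] by (intro card_mono) auto
  then show ?thesis
    using card_semigroup_minus_translate[OF S_add assms(2)] card_delta[OF assms(1)] by simp
qed

lemma L_interpolation:
  assumes "T \<subseteq> I" "card T + 2 * g \<le> r"
  shows "\<exists>h\<in>L r. \<forall>x\<in>T. h x = f x"
proof -
  have "t \<in> S \<and> t < r" if "t \<in> delta T" for t
    using delta_upper[OF assms(1) that] assms(2) that by (simp add: delta_def)
  then have "fvs.span (e ` delta T) \<subseteq> L r"
    unfolding L_def by (intro fvs.span_mono) auto
  then show ?thesis
    using delta_interpolation[OF assms(1), of f] by blast
qed

text \<open>The counterpart of "no more zeros than poles". The inequality is strict because
  \<open>L r\<close> contains only orders below \<open>r\<close>.\<close>

lemma L_zeros: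
  assumes "h \<in> L r" "Z \<subseteq> I" "\<forall>x\<in>Z. h x = 0" "h \<noteq> 0"
  shows "card Z < r"
  using assms(1)
proof (induction r)
  case 0
  then show ?case
    using assms(4) by (simp add: L_def)
next
  case (Suc r)
  show ?case
  proof (cases "h \<in> L r")
    case True
    then show ?thesis
      using Suc.IH by simp
  next
    case False
    then obtain c where c: "r \<in> S" "h - fscale c (e r) \<in> L r"
      using L_Suc[OF Suc.prems] by blast
    then have "c \<noteq> 0"
      using False by auto
    \<comment> \<open>Where \<open>h\<close> vanishes, solving for its leading term writes
      \<open>e r\<close> as the function \<open>k\<close> of lower order, so \<open>r\<close> is not
      new on \<open>Z\<close>.\<close>
    define k where "k = fscale (- inverse c) (h - fscale c (e r))"
    have "k \<in> L r"
      unfolding k_def by (intro L_scale c(2))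
    moreover have "e r x = k x" if "x \<in> Z" for x
      using that assms(3) \<open>c \<noteq> 0\<close> by (simp add: k_def fscale_def)
    ultimately have "r \<notin> delta Z"
      unfolding delta_def by blast
    then show ?thesis
      using card_le_if_not_delta[OF assms(2) c(1)] by simp
  qed
qed

text \<open>A nonzero top coefficient at \<open>b\<close> would make \<open>e b\<close> agree on
  \<open>I\<close> with a function of lower order, forcing \<open>card I \<le> b\<close>. Hence the
  orders from \<open>a + 1\<close> to \<open>b\<close> are independent modulo
  \<open>L (Suc a)\<close> even after evaluation.\<close>

lemma top_part_unique:
  assumes "a \<le> b" "b < card I" "{a<..b} \<subseteq> S"
    and "h \<in> L (Suc a)" "\<forall>x\<in>I. (\<Sum>t\<in>{a<..b}. c t * e t x) = h x"
  shows "\<forall>t\<in>{a<..b}. c t = 0"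
  using assms
proof (induction "b - a" arbitrary: b)
  case (Suc n)
  then have b: "{a<..b} = insert b {a<..b - 1}" "b \<in> S" "a < b"
    by auto
  define k where "k = h - (\<Sum>t\<in>{a<..b - 1}. fscale (c t) (e t))"
  have "k \<in> L b"
    unfolding k_def
  proof (rule L_diff)
    show "h \<in> L b"
      using Suc.prems(4) L_mono[of "Suc a" b] b(3) by auto
    show "(\<Sum>t\<in>{a<..b - 1}. fscale (c t) (e t)) \<in> L b"
      unfolding L_def
      by (intro fvs.span_sum fvs.span_scale fvs.span_base) (use Suc.prems(3) b in auto)
  qed
  have k: "c b * e b x = k x" if "x \<in> I" for x
    using Suc.prems(5) that b(3) unfolding b(1)
    by (simp add: k_def sum_fun_apply fscale_def algebra_simps)
  have "c b = 0"
  proof (rule ccontr)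
    assume "c b \<noteq> 0"
    have "fscale (inverse (c b)) k \<in> L b"
      using \<open>k \<in> L b\<close> by (rule L_scale)
    moreover have "e b x = fscale (inverse (c b)) k x" if "x \<in> I" for x
      using k[OF that] \<open>c b \<noteq> 0\<close> by (simp add: fscale_def flip: k[OF that])
    ultimately have "b \<notin> delta I"
      unfolding delta_def by blast
    then show False
      using card_le_if_not_delta[OF subset_refl b(2)] Suc.prems(2) by simp
  qed
  moreover have "\<forall>t\<in>{a<..b - 1}. c t = 0"
  proof (rule Suc.hyps(1))
    show "\<forall>x\<in>I. (\<Sum>t\<in>{a<..b - 1}. c t * e t x) = h x"
      using Suc.prems(5) b \<open>c b = 0\<close> by simp
  qed (use Suc.prems Suc.hyps(2) b in auto)
  ultimately show ?case
    unfolding b(1) by blast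
qed auto

end

text \<open>The nested codes are the evaluations of \<open>L (Suc a)\<close> and
  \<open>L (Suc (a + s))\<close>; combinations of the \<open>s\<close> orders in between form the
  transversal. All these orders lie in \<open>S\<close> by \<open>2 * g \<le> a + 1\<close>. The
  bound \<open>d + 2 * g \<le> a + 2\<close> gives interpolation on fewer than \<open>d\<close>
  points, and \<open>d + a + s \<le> N\<close> gives the weight bound.\<close>

lemma eval_filtration_quantum_code:
  fixes e :: "nat \<Rightarrow> nat \<Rightarrow> 'a::{finite,field}"
  assumes "eval_filtration S e {..<N} g"
    and "a + s < N" "s > 0" "d > 0" "d + 2 * g \<le> a + 2" "d + a + s \<le> N" "2 * g \<le> a + 1"
  shows "\<exists>D V. quantum_code CARD('a) N s D V \<and> D \<ge> d"
proof -
  interpret eval_filtration S e "{..<N}" g by fact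
  define b where "b = a + s"
  let ?I = "{..<N}"
  define top where "top c = (\<Sum>t\<in>{a<..b}. fscale (c t) (e t))" for c
  define coeffs where "coeffs = {a<..b} \<rightarrow>\<^sub>E (UNIV :: 'a set)"
  have S: "{a<..b} \<subseteq> S"
    using in_S_if_large assms(7) by auto
  have restr_diff: "restr ?I f - restr ?I h = restr ?I (f - h)" for f h :: "nat \<Rightarrow> 'a"
    by (auto simp: restr_def fun_eq_iff)
  have top_L: "top c \<in> L (Suc b)" for c
    unfolding top_def L_def using S
    by (intro fvs.span_sum fvs.span_scale fvs.span_base) auto
  have uniq: "c = c'" if cc: "c \<in> coeffs" "c' \<in> coeffs"
    "restr ?I (top c) - restr ?I (top c') \<in> restr ?I ` L (Suc a)" for c c'
  proof -
    obtain h where h: "h \<in> L (Suc a)" "restr ?I (top c - top c') = restr ?I h"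
      using cc(3) unfolding restr_diff by blast
    have "\<forall>x\<in>?I. (\<Sum>t\<in>{a<..b}. (c t - c' t) * e t x) = h x"
    proof
      fix x assume "x \<in> ?I"
      then have "(top c - top c') x = h x"
        using fun_cong[OF h(2), of x] by (simp add: restr_def)
      then show "(\<Sum>t\<in>{a<..b}. (c t - c' t) * e t x) = h x"
        by (simp add: top_def sum_fun_apply fscale_def sum_subtractf left_diff_distrib)
    qed
    then have "\<forall>t\<in>{a<..b}. c t - c' t = 0"
      using top_part_unique[OF _ _ S h(1), of "\<lambda>t. c t - c' t"] assms(2) by (simp add: b_def)
    then show ?thesis
      using cc(1,2) unfolding coeffs_def by (metis PiE_ext eq_iff_diff_eq_0)
  qed
  have zero_in: "0 \<in> restr ?I ` L (Suc a)"
    by (rule image_eqI[of _ _ 0]) (auto simp: restr_def L_def fvs.span_zero)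
  have inj: "inj_on (\<lambda>c. restr ?I (top c)) coeffs"
    using uniq zero_in by (intro inj_onI) (metis diff_self)
  have Q: "CARD('a) > 1"
    using card_mono[of UNIV "{0, 1 :: 'a}"] by simp
  show ?thesis
  proof (rule css_construction[where ?C1.0 = "restr ?I ` L (Suc a)"
        and ?C2.0 = "restr ?I ` L (Suc b)" and R = "(\<lambda>c. restr ?I (top c)) ` coeffs"])
    show "x - y \<in> restr ?I ` L (Suc a)" if "x \<in> restr ?I ` L (Suc a)" "y \<in> restr ?I ` L (Suc a)" for x y
      using that L_diff by (auto simp: restr_diff)
    show "x - y \<in> restr ?I ` L (Suc b)" if "x \<in> restr ?I ` L (Suc b)" "y \<in> restr ?I ` L (Suc b)" for x y
      using that L_diff by (auto simp: restr_diff)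
    show "restr ?I ` L (Suc a) \<noteq> {}"
      using zero_in by blast
    show "restr ?I ` L (Suc a) \<subseteq> restr ?I ` L (Suc b)"
      using L_mono[of "Suc a" "Suc b"] by (auto simp: b_def)
    show "x i = 0" if "x \<in> restr ?I ` L (Suc b)" "i \<ge> N" for x i
      using that by (auto simp: restr_def)
    show "(\<lambda>c. restr ?I (top c)) ` coeffs \<subseteq> restr ?I ` L (Suc b)"
      using top_L by auto
    show "card ((\<lambda>c. restr ?I (top c)) ` coeffs) = CARD('a) ^ s"
      using inj by (simp add: card_image coeffs_def card_PiE b_def)
    show "CARD('a) ^ s > 1"
      using Q assms(3) by (rule one_less_power)
    show "x = y" if "x \<in> (\<lambda>c. restr ?I (top c)) ` coeffs" "y \<in> (\<lambda>c. restr ?I (top c)) ` coeffs"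
      "x - y \<in> restr ?I ` L (Suc a)" for x y
      using that uniq by blast
    show "d > 0" by fact
    show "d \<le> card {i. i < N \<and> x i \<noteq> 0}" if x: "x \<in> restr ?I ` L (Suc b)" "x \<noteq> 0" for x
    proof -
      obtain h where h: "h \<in> L (Suc b)" "x = restr ?I h"
        using x(1) by blast
      define Z where "Z = {i. i < N \<and> x i = 0}"
      have "h \<noteq> 0"
        using h(2) x(2) by (metis restr_def zero_fun_apply ext)
      then have "card Z < Suc b"
        using h by (intro L_zeros[of h]) (auto simp: Z_def restr_def)
      moreover have "card {i. i < N \<and> x i \<noteq> 0} + card Z = N"
      proof -
        have "{i. i < N \<and> x i \<noteq> 0} \<union> Z = {..<N}" "{i. i < N \<and> x i \<noteq> 0} \<inter> Z = {}"
          by (auto simp: Z_def)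
        then show ?thesis
          by (metis card_Un_disjoint card_lessThan finite_Un finite_lessThan)
      qed
      ultimately show ?thesis
        using assms(6) by (simp add: b_def)
    qed
    show "\<exists>c\<in>restr ?I ` L (Suc a). \<forall>i\<in>T. c i = f i" if T: "T \<subseteq> {..<N}" "card T < d" for T f
    proof -
      obtain h where "h \<in> L (Suc a)" "\<forall>i\<in>T. h i = f i"
        using L_interpolation[OF T(1), of "Suc a" f] T(2) assms(5) by auto
      then show ?thesis
        using T(1) by (intro bexI[of _ "restr ?I h"]) (auto simp: restr_def)
    qed
  qed
qed

section \<open>The coordinate ring of the curve\<close>

text \<open>Points are numbered by naturals, and \<open>x\<close>, \<open>y\<close>,
  \<open>z\<close> are the coordinate functions on the Garcia-Gueneri-Stichtenoth curve.\<close>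

locale ggs_ring =
  fixes q n m :: nat and x y z :: "nat \<Rightarrow> 'a::finite_field"
  assumes q: "q \<ge> 2" and n: "n \<ge> 3" and m: "m * (q + 1) = q ^ n + 1"
    and eq_xy: "x p ^ q + x p = y p ^ (q + 1)"
    and eq_yz: "y p ^ (q ^ 2) - y p = z p ^ m"
begin

text \<open>The pole orders of \<open>x\<close>, \<open>y\<close>, \<open>z\<close> at the point at infinity are \<open>q^n + 1\<close>, \<open>m q\<close> and \<open>q^3\<close>.\<close>
definition weight :: "nat \<Rightarrow> nat \<Rightarrow> nat \<Rightarrow> nat" where
  "weight i j k = i * (q ^ n + 1) + j * (m * q) + k * q ^ 3"

definition mon :: "nat \<Rightarrow> nat \<Rightarrow> nat \<Rightarrow> nat \<Rightarrow> 'a" where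
  "mon i j k = (\<lambda>p. x p ^ i * y p ^ j * z p ^ k)"

definition orders :: "nat set" where
  "orders = {weight i j k | i j k. i < q \<and> j < q ^ 2}"

text \<open>For \<open>r\<close> in \<open>orders\<close> the choice is forced, since the reduced
  monomials have distinct weights by \<open>weight_inj\<close>.\<close>

definition of_order :: "nat \<Rightarrow> nat \<Rightarrow> 'a" where
  "of_order r = (SOME f. \<exists>i j k. i < q \<and> j < q ^ 2 \<and> weight i j k = r \<and> f = mon i j k)"

definition lower :: "nat \<Rightarrow> (nat \<Rightarrow> 'a) set" where
  "lower r = fvs.span (of_order ` {t \<in> orders. t < r})"

lemma coprime_m_q: "coprime m q"
proof -
  have "n \<noteq> 0"
    using n by simp
  moreover have "coprime (q ^ n + 1) (q ^ n)"
    by (metis Suc_eq_plus1 coprime_Suc_left_nat)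
  ultimately have "coprime (q ^ n + 1) q"
    using coprime_power_right_iff[of "q ^ n + 1" q n] by blast
  then have "coprime (m * (q + 1)) q"
    using m by simp
  then show ?thesis
    by (simp only: coprime_mult_left_iff)
qed

text \<open>Modulo \<open>q\<close> a weight is \<open>i\<close>. After removing \<open>i\<close>
  and dividing by \<open>q\<close>, the residue modulo \<open>q ^ 2\<close> is that of
  \<open>j * m\<close>, which determines \<open>j\<close> because \<open>m\<close> is coprime to
  \<open>q\<close>.\<close>

lemma weight_inj:
  assumes "i < q" "j < q ^ 2" "i' < q" "j' < q ^ 2" "weight i j k = weight i' j' k'"
  shows "i = i' \<and> j = j' \<and> k = k'"
proof -
  have "q ^ n = q * q ^ (n - 1)"
    using n by (simp flip: power_Suc)
  then have w: "weight i j k = i + q * (i * q ^ (n - 1) + (j * m + k * q ^ 2))" for i j k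
    by (simp add: weight_def algebra_simps power2_eq_square power3_eq_cube)
  have "weight i j k mod q = i" "weight i' j' k' mod q = i'"
    unfolding w[of i j k] w[of i' j' k'] using assms(1,3) by simp_all
  then have i: "i = i'"
    using assms(5) by simp
  then have jk: "j * m + k * q ^ 2 = j' * m + k' * q ^ 2"
    using assms(5) q unfolding w[of i j k] w[of i' j' k'] by simp
  then have "[j * m = j' * m] (mod q ^ 2)"
    by (metis cong_def mod_mult_self1)
  then have "[j = j'] (mod q ^ 2)"
    using coprime_m_q by (simp add: cong_mult_rcancel_nat)
  then have "j = j'"
    using assms(2,4) by (simp add: cong_def)
  then show ?thesis
    using jk i q by simp
qed

lemma of_order_weight:
  assumes "i < q" "j < q ^ 2"
  shows "of_order (weight i j k) = mon i j k"
proof -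
  let ?P = "\<lambda>f. \<exists>i' j' k'. i' < q \<and> j' < q ^ 2 \<and> weight i' j' k' = weight i j k \<and> f = mon i' j' k'"
  have "?P (mon i j k)"
    by (intro exI[of _ i] exI[of _ j] exI[of _ k] conjI assms refl)
  then have "?P (of_order (weight i j k))"
    unfolding of_order_def by (rule someI[of ?P])
  then obtain i' j' k' where "i' < q" "j' < q ^ 2" "weight i' j' k' = weight i j k"
    "of_order (weight i j k) = mon i' j' k'" by blast
  then show ?thesis
    using weight_inj assms by metis
qed

lemma lower_mono: "r \<le> s \<Longrightarrow> lower r \<subseteq> lower s"
  unfolding lower_def by (intro fvs.span_mono) auto

lemma mon_in_lower:
  assumes "weight i j k \<in> orders" "mon i j k - of_order (weight i j k) \<in> lower (weight i j k)"
    "weight i j k < r"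
  shows "mon i j k \<in> lower r"
proof -
  have "of_order (weight i j k) \<in> lower r"
    unfolding lower_def using assms by (intro fvs.span_base) auto
  moreover have "mon i j k - of_order (weight i j k) \<in> lower r"
    using assms(2,3) lower_mono[of "weight i j k" r] by auto
  ultimately show ?thesis
    unfolding lower_def using fvs.span_add by fastforce
qed

text \<open>Replace \<open>x ^ q\<close> by \<open>y ^ (q + 1) - x\<close>, or
  \<open>y ^ (q ^ 2)\<close> by \<open>z ^ m + y\<close>. The first term keeps the weight and the
  second lowers it. The lexicographic order on weight, \<open>i\<close>, \<open>j\<close>
  terminates: the term of equal weight has smaller \<open>i\<close>, or the same \<open>i\<close>
  and smaller \<open>j\<close>.\<close>

lemma reduction:
  "weight i j k \<in> orders \<and> mon i j k - of_order (weight i j k) \<in> lower (weight i j k)"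
proof (induction "(weight i j k, i, j)" arbitrary: i j k
    rule: wf_induct_rule[OF wf_lex_prod[OF wf_less_than wf_lex_prod[OF wf_less_than wf_less_than]]])
  case less: 1
  consider "i \<ge> q" | "i < q" "j \<ge> q ^ 2" | "i < q" "j < q ^ 2" by linarith
  then show ?case
  proof cases
    case 1
    then obtain i' where i: "i = q + i'"
      by (auto simp: le_iff_add)
    have "q * (q ^ n + 1) = (q + 1) * (m * q)"
      unfolding m[symmetric] by (simp add: algebra_simps)
    then have w: "weight i' (j + (q + 1)) k = weight i j k"
      unfolding weight_def i by (simp only: add_mult_distrib)
    have "(i' + 1) * (q ^ n + 1) < (q + i') * (q ^ n + 1)"
      using q by (intro mult_strict_right_mono) auto
    then have w': "weight (i' + 1) j k < weight i j k"
      unfolding weight_def i by linarith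
    have "mon i j k = mon i' (j + (q + 1)) k - mon (i' + 1) j k"
    proof
      fix p
      have "mon i j k p = x p ^ q * (x p ^ i' * y p ^ j * z p ^ k)"
        by (simp add: mon_def i power_add mult_ac)
      also have "x p ^ q = y p ^ (q + 1) - x p"
        using eq_xy[of p] by (simp add: eq_diff_eq)
      finally show "mon i j k p = (mon i' (j + (q + 1)) k - mon (i' + 1) j k) p"
        by (simp add: mon_def power_add algebra_simps)
    qed
    moreover have "mon (i' + 1) j k \<in> lower (weight i j k)"
      using less[of "i' + 1" j k] w' by (intro mon_in_lower) auto
    moreover have "weight i j k \<in> orders \<and>
        mon i' (j + (q + 1)) k - of_order (weight i j k) \<in> lower (weight i j k)"
      using less[of i' "j + (q + 1)" k] q w i by simp
    moreover have "mon i' (j + (q + 1)) k - mon (i' + 1) j k - of_order (weight i j k) =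
        (mon i' (j + (q + 1)) k - of_order (weight i j k)) - mon (i' + 1) j k"
      by simp
    ultimately show ?thesis
      unfolding lower_def by (simp only: fvs.span_diff simp_thms)
  next
    case 2
    then obtain j' where j: "j = q ^ 2 + j'"
      by (auto simp: le_iff_add)
    have "q ^ 2 * (m * q) = m * q ^ 3"
      by (simp only: power2_eq_square power3_eq_cube mult_ac)
    then have w: "weight i j' (k + m) = weight i j k"
      unfolding weight_def j by (simp only: add_mult_distrib)
    have "m * q > 0"
      using q m by (cases m) auto
    moreover have "1 < q ^ 2"
      using q by (intro one_less_power) auto
    ultimately have "1 * (m * q) < q ^ 2 * (m * q)"
      by (rule mult_strict_right_mono[rotated])
    then have w': "weight i (j' + 1) k < weight i j k"
      unfolding weight_def j by (simp add: add_mult_distrib)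
    have "mon i j k = mon i j' (k + m) + mon i (j' + 1) k"
    proof
      fix p
      have "mon i j k p = y p ^ (q ^ 2) * (x p ^ i * y p ^ j' * z p ^ k)"
        by (simp add: mon_def j power_add mult_ac)
      also have "y p ^ (q ^ 2) = z p ^ m + y p"
        using eq_yz[of p] by (simp add: diff_eq_eq)
      finally show "mon i j k p = (mon i j' (k + m) + mon i (j' + 1) k) p"
        by (simp add: mon_def power_add algebra_simps)
    qed
    moreover have "mon i (j' + 1) k \<in> lower (weight i j k)"
      using less[of i "j' + 1" k] w' by (intro mon_in_lower) auto
    moreover have "weight i j k \<in> orders \<and>
        mon i j' (k + m) - of_order (weight i j k) \<in> lower (weight i j k)"
      using less[of i j' "k + m"] q w j by simp
    moreover have "mon i j' (k + m) + mon i (j' + 1) k - of_order (weight i j k) =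
        (mon i j' (k + m) - of_order (weight i j k)) + mon i (j' + 1) k"
      by simp
    ultimately show ?thesis
      unfolding lower_def by (simp only: fvs.span_add simp_thms)
  next
    case 3
    then show ?thesis
      by (auto simp: of_order_weight lower_def fvs.span_zero orders_def)
  qed
qed

lemma mon_mult: "mon i j k * mon i' j' k' = mon (i + i') (j + j') (k + k')"
  by (simp add: mon_def fun_eq_iff power_add mult_ac)

lemma weight_add: "weight i j k + weight i' j' k' = weight (i + i') (j + j') (k + k')"
  by (simp add: weight_def algebra_simps)

lemma orders_mult:
  assumes "u \<in> orders" "v \<in> orders"
  shows "u + v \<in> orders \<and> of_order u * of_order v - of_order (u + v) \<in> lower (u + v)"
proof -
  obtain i j k i' j' k' where "i < q" "j < q ^ 2" "i' < q" "j' < q ^ 2"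
    "u = weight i j k" "v = weight i' j' k'"
    using assms unfolding orders_def by blast
  then show ?thesis
    using reduction[of "i + i'" "j + j'" "k + k'"] by (simp add: of_order_weight mon_mult weight_add)
qed

section \<open>The gaps of the semigroup of orders and the genus\<close>

definition base_weights :: "(nat \<times> nat) set" where
  "base_weights = {..<q} \<times> {..<q ^ 2}"

lemma bij_weight_mod: "bij_betw (\<lambda>(i, j). weight i j 0 mod q ^ 3) base_weights {..<q ^ 3}"
proof -
  have "i = i' \<and> j = j'" if ij: "i < q" "j < q ^ 2" "i' < q" "j' < q ^ 2"
    "weight i j 0 mod q ^ 3 = weight i' j' 0 mod q ^ 3" for i j i' j'
  proof -
    have "weight i j 0 = weight i j 0 mod q ^ 3 + weight i j 0 div q ^ 3 * q ^ 3"
      "weight i' j' 0 = weight i' j' 0 mod q ^ 3 + weight i' j' 0 div q ^ 3 * q ^ 3"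
      by (simp_all only: mod_div_mult_eq)
    then have "weight i j 0 + weight i' j' 0 div q ^ 3 * q ^ 3 =
        weight i' j' 0 + weight i j 0 div q ^ 3 * q ^ 3"
      using ij(5) by linarith
    \<comment> \<open>Giving each monomial as many factors \<open>z\<close> as the other's quotient
      makes the two weights equal, so \<open>weight_inj\<close> applies.\<close>
    then have "weight i j (weight i' j' 0 div q ^ 3) = weight i' j' (weight i j 0 div q ^ 3)"
      by (simp add: weight_def)
    then show ?thesis
      using weight_inj ij by blast
  qed
  then have inj: "inj_on (\<lambda>(i, j). weight i j 0 mod q ^ 3) base_weights"
    by (auto simp: base_weights_def inj_on_def)
  have "(\<lambda>(i, j). weight i j 0 mod q ^ 3) ` base_weights \<subseteq> {..<q ^ 3}"
    using q by (auto simp: base_weights_def)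
  moreover have "card ((\<lambda>(i, j). weight i j 0 mod q ^ 3) ` base_weights) = card {..<q ^ 3}"
    using inj by (simp add: card_image base_weights_def power2_eq_square power3_eq_cube)
  ultimately have "(\<lambda>(i, j). weight i j 0 mod q ^ 3) ` base_weights = {..<q ^ 3}"
    by (intro card_subset_eq) auto
  then show ?thesis
    using inj by (simp add: bij_betw_def)
qed

text \<open>In its residue class mod \<open>q ^ 3\<close>, a gap lies below the base weight
  \<open>weight i j 0\<close>, since adding factors \<open>z\<close> reaches everything from there
  on.\<close>

lemma gaps_subset:
  "- orders \<subseteq> (\<Union>(i, j)\<in>base_weights. (\<lambda>k. weight i j 0 - Suc k * q ^ 3) ` {..<weight i j 0 div q ^ 3})"
proof
  fix t assume t: "t \<in> - orders"
  have "t mod q ^ 3 \<in> (\<lambda>(i, j). weight i j 0 mod q ^ 3) ` base_weights"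
    using bij_weight_mod q by (simp add: bij_betw_def)
  then obtain i j where ij: "(i, j) \<in> base_weights" "weight i j 0 mod q ^ 3 = t mod q ^ 3"
    by auto
  let ?w = "weight i j 0"
  have "t < ?w"
  proof (rule ccontr)
    assume "\<not> t < ?w"
    then obtain k where "t = ?w + q ^ 3 * k"
      using ij(2) by (metis dvdE le_add_diff_inverse mod_eq_dvd_iff_nat not_less)
    then have "t = weight i j k"
      by (simp add: weight_def)
    then show False
      using t ij(1) by (auto simp: orders_def base_weights_def)
  qed
  then obtain k where k: "?w = t + q ^ 3 * k"
    using ij(2) by (metis dvdE le_add_diff_inverse mod_eq_dvd_iff_nat less_imp_le)
  then obtain k' where k': "k = Suc k'"
    using \<open>t < ?w\<close> by (cases k) auto
  have "k \<le> ?w div q ^ 3"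
    unfolding k using q by simp
  then have "t \<in> (\<lambda>k. ?w - Suc k * q ^ 3) ` {..<?w div q ^ 3}"
    using k k' by (intro image_eqI[of _ _ k']) (simp_all add: algebra_simps)
  then show "t \<in> (\<Union>(i, j)\<in>base_weights. (\<lambda>k. weight i j 0 - Suc k * q ^ 3) ` {..<weight i j 0 div q ^ 3})"
    using ij(1) by blast
qed

lemma finite_base_weights: "finite base_weights"
  by (simp add: base_weights_def)

lemma card_gaps:
  "finite (- orders)" "card (- orders) \<le> (\<Sum>(i, j)\<in>base_weights. weight i j 0 div q ^ 3)"
proof -
  let ?G = "\<lambda>(i, j). (\<lambda>k. weight i j 0 - Suc k * q ^ 3) ` {..<weight i j 0 div q ^ 3}"
  have fin: "finite (\<Union>b\<in>base_weights. ?G b)"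
    using finite_base_weights by auto
  then show "finite (- orders)"
    using gaps_subset finite_subset by blast
  have "card (- orders) \<le> card (\<Union>b\<in>base_weights. ?G b)"
    using gaps_subset fin by (intro card_mono) auto
  also have "\<dots> \<le> (\<Sum>b\<in>base_weights. card (?G b))"
    by (rule card_UN_le[OF finite_base_weights])
  also have "\<dots> \<le> (\<Sum>(i, j)\<in>base_weights. weight i j 0 div q ^ 3)"
    by (intro sum_mono) (auto intro: card_image_le[THEN order_trans])
  finally show "card (- orders) \<le> (\<Sum>(i, j)\<in>base_weights. weight i j 0 div q ^ 3)" .
qed

lemma (in -) sum_id_lessThan: "2 * (\<Sum>i<k. i) = k * (k - 1)" for k :: nat
  by (induction k) (auto simp: algebra_simps)

text \<open>The remainders of the base weights mod \<open>q ^ 3\<close> run once through all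
  residues, so the sum of the quotients follows from the sum of the weights.\<close>

lemma genus:
  "2 * int (\<Sum>(i, j)\<in>base_weights. weight i j 0 div q ^ 3) =
    (int q - 1) * (int q ^ (n + 1) + int q ^ n - int q ^ 2)"
proof -
  define G where "G = (\<Sum>(i, j)\<in>base_weights. weight i j 0 div q ^ 3)"
  have "(\<Sum>(i, j)\<in>base_weights. weight i j 0 mod q ^ 3) = (\<Sum>k<q ^ 3. k)"
    using sum.reindex_bij_betw[OF bij_weight_mod, of "\<lambda>k. k"] by (simp add: case_prod_unfold)
  moreover have "(\<Sum>(i, j)\<in>base_weights. weight i j 0) =
      (\<Sum>(i, j)\<in>base_weights. weight i j 0 div q ^ 3 * q ^ 3 + weight i j 0 mod q ^ 3)"
    by (simp only: div_mult_mod_eq)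
  ultimately have W1: "(\<Sum>(i, j)\<in>base_weights. weight i j 0) = G * q ^ 3 + (\<Sum>k<q ^ 3. k)"
    by (simp add: G_def case_prod_unfold sum.distrib sum_distrib_right del: div_mult_mod_eq)
  have "(\<Sum>(i, j)\<in>base_weights. weight i j 0) =
      (\<Sum>i<q. \<Sum>j<q ^ 2. i * (q ^ n + 1) + j * (m * q))"
    by (simp add: base_weights_def sum.cartesian_product weight_def)
  also have "\<dots> = q ^ 2 * ((\<Sum>i<q. i) * (q ^ n + 1)) + q * ((\<Sum>j<q ^ 2. j) * (m * q))"
    by (simp only: sum.distrib sum_constant of_nat_id card_lessThan sum_distrib_right[symmetric]
        sum_distrib_left[symmetric])
  finally have "2 * (G * q ^ 3 + (\<Sum>k<q ^ 3. k)) =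
      q ^ 2 * ((2 * (\<Sum>i<q. i)) * (q ^ n + 1)) + q * ((2 * (\<Sum>j<q ^ 2. j)) * (m * q))"
    unfolding W1 by (simp add: algebra_simps)
  then have "2 * G * q ^ 3 + q ^ 3 * (q ^ 3 - 1) =
      q ^ 2 * ((q * (q - 1)) * (q ^ n + 1)) + q * ((q ^ 2 * (q ^ 2 - 1)) * (m * q))"
    unfolding sum_id_lessThan[symmetric] by (simp add: algebra_simps)
  then have "int (2 * G * q ^ 3 + q ^ 3 * (q ^ 3 - 1)) =
      int (q ^ 2 * ((q * (q - 1)) * (q ^ n + 1)) + q * ((q ^ 2 * (q ^ 2 - 1)) * (m * q)))"
    by simp
  moreover have "int (q - 1) = int q - 1" "int (q ^ 2 - 1) = int q ^ 2 - 1" "int (q ^ 3 - 1) = int q ^ 3 - 1"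
    using q by (simp_all add: of_nat_diff)
  ultimately have "2 * int G * int q ^ 3 + int q ^ 3 * (int q ^ 3 - 1) =
      int q ^ 2 * ((int q * (int q - 1)) * (int q ^ n + 1)) +
      int q * ((int q ^ 2 * (int q ^ 2 - 1)) * (int m * int q))"
    by (simp only: of_nat_add of_nat_mult of_nat_power of_nat_numeral of_nat_1)
  also have "\<dots> = int q ^ 3 * ((int q - 1) * (int q ^ n + 1) + (int q - 1) * int q * (int m * (int q + 1)))"
    by (simp add: power2_eq_square power3_eq_cube algebra_simps)
  also have "int m * (int q + 1) = int q ^ n + 1"
    using m by (metis of_nat_1 of_nat_add of_nat_mult of_nat_power)
  finally have "int q ^ 3 * (2 * int G) = int q ^ 3 * ((int q - 1) * (int q ^ (n + 1) + int q ^ n - int q ^ 2))"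
    by (simp add: power2_eq_square power3_eq_cube algebra_simps)
  then show ?thesis
    using q by (simp add: G_def)
qed

text \<open>Polynomials in \<open>x\<close>, \<open>y\<close>, \<open>z\<close> form an algebra
  \<open>M\<close> containing the indicator of each point, and by \<open>reduction\<close> each of
  them has bounded order.\<close>

lemma interpolation:
  assumes inj: "inj_on (\<lambda>p. (x p, y p, z p)) {..<N}"
  shows "\<exists>r. \<exists>h\<in>lower r. \<forall>p\<in>{..<N}. h p = f p"
proof -
  define M where "M = fvs.span {mon i j k | i j k. True}"
  have sub: "\<exists>r. h \<in> lower r" if "h \<in> M" for h
    using that unfolding M_def
  proof (induction rule: fvs.span_induct_alt)
    case base
    then show ?case
      unfolding lower_def by (intro exI) (rule fvs.span_zero)
  next
    case (step c f h)
    then obtain i j k r where f: "f = mon i j k" "h \<in> lower r" by blast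
    let ?s = "max (Suc (weight i j k)) r"
    have "f \<in> lower ?s"
      unfolding f(1) using reduction by (intro mon_in_lower) auto
    moreover have "h \<in> lower ?s"
      using f(2) lower_mono[of r ?s] by auto
    ultimately have "fscale c f + h \<in> lower ?s"
      unfolding lower_def by (intro fvs.span_add fvs.span_scale)
    then show ?case ..
  qed
  have mon: "mon i j k \<in> M" for i j k
    unfolding M_def by (intro fvs.span_base) blast
  have mult_mon: "f * mon i j k \<in> M" if "f \<in> M" for f i j k
    using that unfolding M_def
  proof (induction rule: fvs.span_induct_alt)
    case base
    then show ?case
      by (simp add: fvs.span_zero flip: zero_fun_def)
  next
    case (step c f h)
    have eq: "(fscale c f + h) * mon i j k = fscale c (f * mon i j k) + h * mon i j k"
      by (simp add: fscale_def fun_eq_iff algebra_simps)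
    have "f * mon i j k \<in> M"
      using step(1) mon_mult mon by auto
    then show ?case
      unfolding eq M_def by (intro fvs.span_add fvs.span_scale step(2))
  qed
  have mult: "f * h \<in> M" if "f \<in> M" "h \<in> M" for f h
    using that(2) unfolding M_def
  proof (induction rule: fvs.span_induct_alt)
    case base
    then show ?case
      by (simp add: fvs.span_zero flip: zero_fun_def)
  next
    case (step c e h)
    have eq: "f * (fscale c e + h) = fscale c (f * e) + f * h"
      by (simp add: fscale_def fun_eq_iff algebra_simps)
    have "f * e \<in> M"
      using step(1) mult_mon[OF that(1)] by auto
    then show ?case
      unfolding eq M_def by (intro fvs.span_add fvs.span_scale step(2))
  qed
  have const: "(\<lambda>_. c) \<in> M" for c
  proof -
    have "(\<lambda>_. c) = fscale c (mon 0 0 0)"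
      by (simp add: fscale_def mon_def)
    then show ?thesis
      using mon[of 0 0 0] unfolding M_def by (simp add: fvs.span_scale)
  qed
  have diff: "(\<lambda>p. f p - h p) \<in> M" if "f \<in> M" "h \<in> M" for f h
    using fvs.span_diff[of f _ h] that unfolding M_def by (simp add: fun_diff_def)
  have pow: "(\<lambda>p. f p ^ k) \<in> M" if "f \<in> M" for f k
  proof (induction k)
    case 0
    then show ?case using const[of 1] by simp
  next
    case (Suc k)
    have "(\<lambda>p. f p ^ Suc k) = f * (\<lambda>p. f p ^ k)"
      by (simp add: fun_eq_iff)
    then show ?case
      using mult[OF that Suc] by simp
  qed
  have x: "x \<in> M" and y: "y \<in> M" and z: "z \<in> M"
    using mon[of 1 0 0] mon[of 0 1 0] mon[of 0 0 1] by (simp_all add: mon_def)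
  \<comment> \<open>In a finite field every nonzero element has (\<open>CARD('a) - 1\<close>)-th
    power 1, so this polynomial in \<open>u\<close> selects the points where \<open>u\<close> takes
    the value \<open>a\<close>.\<close>
  define sel where "sel u a = (\<lambda>p. 1 - (u p - a) ^ (CARD('a) - 1))" for u :: "nat \<Rightarrow> 'a" and a
  have sel_M: "sel u a \<in> M" if "u \<in> M" for u a
    unfolding sel_def by (intro diff pow const that)
  have sel: "sel u a p = (if u p = a then 1 else 0)" for u a p
  proof (cases "u p = a")
    case True
    have "CARD('a) > 1"
      using card_mono[of UNIV "{0, 1 :: 'a}"] by simp
    then show ?thesis
      using True by (simp add: sel_def)
  next
    case False
    have "(u p - a) * (u p - a) ^ (CARD('a) - 1) = (u p - a) * 1"
      using finite_field_power_card_eq_same[of "u p - a"] by (simp flip: power_Suc)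
    then show ?thesis
      using False by (simp add: sel_def)
  qed
  define ind where "ind a = sel x (x a) * (sel y (y a) * sel z (z a))" for a
  have ind_M: "ind a \<in> M" for a
    unfolding ind_def by (intro mult sel_M x y z)
  have ind: "ind a p = (if p = a then 1 else 0)" if "p < N" "a < N" for a p
    using inj that by (auto simp: ind_def sel inj_on_def)
  have "(\<Sum>a<N. fscale (f a) (ind a)) \<in> M"
    using ind_M unfolding M_def by (intro fvs.span_sum fvs.span_scale)
  moreover have "(\<Sum>a<N. fscale (f a) (ind a)) p = f p" if "p < N" for p
  proof -
    have "(\<Sum>a<N. fscale (f a) (ind a)) p = (\<Sum>a<N. f a * ind a p)"
      by (simp add: sum_fun_apply fscale_def)
    also have "\<dots> = (\<Sum>a<N. if a = p then f p else 0)"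
      using ind that by (intro sum.cong) auto
    finally have "(\<Sum>a<N. fscale (f a) (ind a)) p = (\<Sum>a<N. if a = p then f p else 0)" .
    then show ?thesis
      using that by simp
  qed
  ultimately show ?thesis
    using sub by blast
qed

lemma filtration:
  assumes "inj_on (\<lambda>p. (x p, y p, z p)) {..<N}"
    and "2 * int g = (int q - 1) * (int q ^ (n + 1) + int q ^ n - int q ^ 2)"
  shows "eval_filtration orders of_order {..<N} g"
proof
  show "card (- orders) \<le> g"
    using card_gaps(2) genus assms(2) by linarith
qed (use orders_mult card_gaps(1) interpolation[OF assms(1)] in \<open>auto simp: lower_def\<close>)

end

section \<open>Rational points of the curve\<close>

text \<open>When the upper bounds on fibres and target already multiply to at most the size of the
  source, every fibre must be full. The exact root counts below rest on this together with degree
  bounds.\<close>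

lemma card_fibre_eq:
  assumes "finite A" "finite B" "f ` A \<subseteq> B" "\<And>b. b \<in> B \<Longrightarrow> card {a \<in> A. f a = b} \<le> d"
    and "d * card B \<le> card A" "b \<in> B"
  shows "card {a \<in> A. f a = b} = d"
proof (rule ccontr)
  assume "card {a \<in> A. f a = b} \<noteq> d"
  then have "card {a \<in> A. f a = b} < d"
    using assms(4)[OF assms(6)] by simp
  then have "(\<Sum>b\<in>B. card {a \<in> A. f a = b}) < (\<Sum>b\<in>B. d)"
    using assms by (intro sum_strict_mono_ex1) auto
  moreover have "(\<Sum>b\<in>B. card {a \<in> A. f a = b}) = card A"
    using sum.group[of A B f "\<lambda>_. 1::nat"] assms by simp
  ultimately show False
    using assms(5) by (simp add: mult.commute)
qed

section \<open>Degree bounds and alternating sums\<close>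

lemma card_roots_linearized_le:
  fixes a c :: "'a::idom"
  assumes "d \<ge> 2"
  shows "card {x. x ^ d + a * x = c} \<le> d"
proof -
  let ?p = "monom 1 d + [:- c, a:]"
  have deg: "degree ?p = d"
    using assms by (subst degree_add_eq_left) (simp_all add: degree_monom_eq)
  then have "?p \<noteq> 0"
    using assms by auto
  then have "card {x. poly ?p x = 0} \<le> d"
    using card_poly_roots_bound[of ?p] deg by simp
  moreover have "{x. poly ?p x = 0} = {x. x ^ d + a * x = c}"
    by (auto simp: poly_monom algebra_simps eq_neg_iff_add_eq_0)
  ultimately show ?thesis by simp
qed

lemma card_power_roots_le:
  fixes c :: "'a::idom"
  assumes "d \<ge> 1"
  shows "card {x. x ^ d = c} \<le> d"
proof -
  let ?p = "monom 1 d + [:- c:]"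
  have deg: "degree ?p = d"
    using assms by (subst degree_add_eq_left) (simp_all add: degree_monom_eq)
  then have "?p \<noteq> 0"
    using assms by auto
  then have "card {x. poly ?p x = 0} \<le> d"
    using card_poly_roots_bound[of ?p] deg by simp
  moreover have "{x. poly ?p x = 0} = {x. x ^ d = c}"
    by (auto simp: poly_monom)
  ultimately show ?thesis by simp
qed

lemma sum_alternating_telescope:
  fixes a :: "nat \<Rightarrow> 'a::comm_ring_1"
  shows "(\<Sum>i<k. (-1) ^ i * (a i + a (Suc i))) = a 0 - (-1) ^ k * a k"
  by (induction k) (auto simp: algebra_simps)

lemma sum_alternating_const:
  fixes c :: "'a::comm_ring_1"
  shows "(\<Sum>i<k. (-1) ^ i * c) = (if even k then 0 else c)"
  by (induction k) auto

lemma sum_lessThan_add: "(\<Sum>i<m + k. f i) = (\<Sum>i<m. f i) + (\<Sum>i<k. f (m + i))"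
  for f :: "nat \<Rightarrow> 'a::comm_monoid_add"
  by (induction k) (simp_all add: add.assoc)

locale square_field =
  fixes q n :: nat and F :: "'a::finite_field itself"
  assumes q: "primepow q" and n: "odd n" and card_F: "CARD('a) = q ^ (2 * n)"
begin

section \<open>Frobenius powers and root counts in the field with \<open>q ^ (2 * n)\<close>
  elements\<close>

lemma q_ge: "q \<ge> 2"
  using primepow_gt_Suc_0[OF q] by simp

lemma n_pos: "n > 0"
  using n by (cases n) auto

lemma frob_add: "(u + v :: 'a) ^ (q ^ i) = u ^ (q ^ i) + v ^ (q ^ i)"
proof -
  obtain p e where p: "prime p" "e > 0" "q = p ^ e"
    using q unfolding primepow_def by blast
  have "CHAR('a) dvd p ^ (e * (2 * n))"
    using CHAR_dvd_CARD[where 'a = 'a] card_F p(3) by (simp add: power_mult)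
  then have "CHAR('a) = p"
    using p(1) CHAR_prime[where 'a = 'a] by (metis prime_dvd_power primes_dvd_imp_eq)
  then show ?thesis
    using p by (intro freshmans_dream'[where n = "e * i"]) (auto simp: power_mult)
qed

lemma frob_uminus: "(- u :: 'a) ^ (q ^ i) = - (u ^ (q ^ i))"
proof -
  have "(u + - u) ^ (q ^ i) = u ^ (q ^ i) + (- u) ^ (q ^ i)"
    by (rule frob_add)
  moreover have "(0 :: 'a) ^ (q ^ i) = 0"
    using q_ge by (simp add: power_0_left)
  ultimately show ?thesis
    by (simp add: eq_neg_iff_add_eq_0 add.commute)
qed

lemma frob_diff: "(u - v :: 'a) ^ (q ^ i) = u ^ (q ^ i) - v ^ (q ^ i)"
  using frob_add[of u "- v" i] by (simp add: frob_uminus)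

lemma frob_frob: "((u :: 'a) ^ (q ^ i)) ^ (q ^ j) = u ^ (q ^ (i + j))"
  by (simp add: power_add power_mult)

lemma power_card: "(u :: 'a) ^ (q ^ (2 * n)) = u"
  using finite_field_power_card_eq_same[of u] card_F by simp

lemma power_card_minus_1: "(u :: 'a) \<noteq> 0 \<Longrightarrow> u ^ (q ^ (2 * n) - 1) = 1"
proof -
  assume "u \<noteq> 0"
  have "u * u ^ (q ^ (2 * n) - 1) = u ^ (q ^ (2 * n))"
    using q_ge by (simp flip: power_Suc)
  with power_card[of u] \<open>u \<noteq> 0\<close> show ?thesis by simp
qed

text \<open>The \<open>d\<close>-th power map sends the \<open>d * e\<close> nonzero elements into
  the at most \<open>e\<close> roots of unity of order dividing \<open>e\<close>, with fibres of
  size at most \<open>d\<close>; so all fibres are full.\<close>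

lemma card_power_roots:
  fixes w :: 'a
  assumes de: "d * e = q ^ (2 * n) - 1" and w: "w ^ e = 1"
  shows "card {z. z ^ d = w} = d"
proof -
  have "q ^ (2 * n) > 1"
    using q_ge n_pos by (intro one_less_power) auto
  then have "d * e > 0"
    using de by simp
  then have pos: "d > 0" "e > 0"
    by auto
  have "w \<noteq> 0"
    using w pos by (metis power_0_left zero_neq_one less_numeral_extra(3))
  have "card {a \<in> UNIV - {0}. a ^ d = w} = d"
  proof (rule card_fibre_eq[where B = "{w. w ^ e = 1}"])
    show "(\<lambda>a. a ^ d) ` (UNIV - {0}) \<subseteq> {w :: 'a. w ^ e = 1}"
      using power_card_minus_1 by (auto simp: de simp flip: power_mult)
    show "card {a \<in> UNIV - {0}. a ^ d = b} \<le> d" for b :: 'a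
      using card_power_roots_le[of d b] pos card_mono[of "{a. a ^ d = b}" "{a \<in> UNIV - {0}. a ^ d = b}"]
      by (auto intro: order_trans)
    have "card {w :: 'a. w ^ e = 1} \<le> e"
      using card_power_roots_le[of e "1 :: 'a"] pos by simp
    then have "d * card {w :: 'a. w ^ e = 1} \<le> d * e"
      by simp
    also have "\<dots> = card (UNIV - {0 :: 'a})"
      by (simp add: de card_F card_Diff_singleton)
    finally show "d * card {w :: 'a. w ^ e = 1} \<le> card (UNIV - {0 :: 'a})" .
  qed (use w in auto)
  moreover have "{a \<in> UNIV - {0}. a ^ d = w} = {z. z ^ d = w}"
    using \<open>w \<noteq> 0\<close> pos by auto
  ultimately show ?thesis by simp
qed

text \<open>The alternating signs adapt the trace to \<open>x ^ q + x\<close>: on such elements the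
  sum telescopes to \<open>x - x ^ (q ^ (2 * n)) = 0\<close>.\<close>

definition alt_trace :: "'a \<Rightarrow> 'a" where
  "alt_trace c = (\<Sum>i<2 * n. (-1) ^ i * c ^ (q ^ i))"

text \<open>An additive analogue of Hilbert 90.\<close>
lemma card_artin_schreier_roots:
  assumes "alt_trace c = 0"
  shows "card {x :: 'a. x ^ q + x = c} = q"
proof -
  have "card {x \<in> UNIV. x ^ q + x = c} = q"
  proof (rule card_fibre_eq[where B = "{c. alt_trace c = 0}"])
    show "(\<lambda>x. x ^ q + x) ` UNIV \<subseteq> {c. alt_trace c = 0}"
    proof safe
      fix x :: 'a
      have "alt_trace (x ^ q + x) = (\<Sum>i<2 * n. (-1) ^ i * (x ^ (q ^ i) + x ^ (q ^ Suc i)))"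
        unfolding alt_trace_def using frob_frob[of x 1]
        by (intro sum.cong) (simp_all add: frob_add add.commute)
      also have "\<dots> = x ^ (q ^ 0) - (-1) ^ (2 * n) * x ^ (q ^ (2 * n))"
        by (rule sum_alternating_telescope)
      finally show "alt_trace (x ^ q + x) = 0"
        by (simp add: power_card)
    qed
    show "card {x \<in> UNIV. x ^ q + x = b} \<le> q" for b :: 'a
      using card_roots_linearized_le[OF q_ge, of 1 b] by simp
    \<comment> \<open>As a nonzero polynomial of degree at most \<open>q ^ (2 * n - 1)\<close>, the
      alternating trace has few enough zeros for \<open>card_fibre_eq\<close>.\<close>
    let ?p = "\<Sum>i<2 * n. monom ((-1) ^ i) (q ^ i) :: 'a poly"
    have "coeff ?p (q ^ (2 * n - 1)) = (\<Sum>i<2 * n. if i = 2 * n - 1 then (-1) ^ i else 0)"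
      unfolding coeff_sum using q_ge by (intro sum.cong) (auto simp: power_inject_exp)
    also have "\<dots> \<noteq> 0"
      using n_pos by simp
    finally have "?p \<noteq> 0"
      by auto
    then have "card {c. poly ?p c = 0} \<le> degree ?p"
      by (rule card_poly_roots_bound)
    also have "degree ?p \<le> q ^ (2 * n - 1)"
    proof (rule degree_sum_le)
      fix i assume "i \<in> {..<2 * n}"
      then have "q ^ i \<le> q ^ (2 * n - 1)"
        using q_ge by (intro power_increasing) auto
      then show "degree (monom ((-1) ^ i) (q ^ i) :: 'a poly) \<le> q ^ (2 * n - 1)"
        using degree_monom_le order_trans by blast
    qed simp
    finally have "card {c. alt_trace c = 0} \<le> q ^ (2 * n - 1)"
      by (simp add: poly_sum poly_monom alt_trace_def)
    then have "q * card {c. alt_trace c = 0} \<le> q * q ^ (2 * n - 1)"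
      by simp
    also have "\<dots> = CARD('a)"
      using n_pos by (simp add: card_F flip: power_Suc)
    finally show "q * card {c. alt_trace c = 0} \<le> CARD('a)" .
  qed (use assms in auto)
  then show ?thesis by simp
qed

lemma norm_1_frob:
  fixes l :: 'a
  assumes "l ^ (q + 1) = 1"
  shows "l ^ (q ^ i) * l ^ (q ^ Suc i) = 1" "l \<noteq> 0" "l ^ (q ^ 2) = l"
proof -
  have 1: "l * l ^ q = 1"
    using assms by simp
  then have "(l * l ^ q) ^ (q ^ i) = 1"
    by simp
  then show "l ^ (q ^ i) * l ^ (q ^ Suc i) = 1"
    by (simp add: power_mult_distrib power_mult)
  show "l \<noteq> 0"
    using 1 by auto
  have "l ^ q * l ^ (q ^ 2) = (l * l ^ q) ^ q"
    by (simp only: power_mult_distrib power2_eq_square power_mult)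
  then have "l ^ q * l ^ (q ^ 2) = l ^ q * l"
    using 1 by (simp add: mult.commute)
  then show "l ^ (q ^ 2) = l"
    using \<open>l \<noteq> 0\<close> by simp
qed

text \<open>The element is fixed by the \<open>q ^ 2\<close>-Frobenius, so only the parity of
  \<open>n\<close> matters.\<close>

lemma frob_odd:
  fixes u :: 'a
  assumes "u ^ (q ^ 2) = u"
  shows "u ^ (q ^ n) = u ^ q"
proof -
  obtain k where k: "n = 2 * k + 1"
    using n by (auto elim: oddE)
  have "u ^ (q ^ (2 * k)) = u"
    using assms by (induction k) (simp_all add: power_add power_mult power2_eq_square)
  moreover have "u ^ (q ^ n) = (u ^ (q ^ (2 * k))) ^ q"
    by (simp only: k power_add power_one_right power_mult)
  ultimately show ?thesis
    by simp
qed

text \<open>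
  A nonzero \<open>w = y^(q^2) - y\<close> is an \<open>m\<close>-th power iff \<open>w^(q^n) = l w\<close> for some \<open>l\<close> with \<open>l^(q+1) = 1\<close>,
  that is, iff \<open>u = y^(q^n) - l y\<close> is fixed by the \<open>q^2\<close>-Frobenius. Raising
  \<open>y^(q^n) = l y + u\<close> to the power \<open>q^n\<close> then gives \<open>l u^q = - u\<close>.
\<close>
definition norm_pairs :: "('a \<times> 'a) set" where
  "norm_pairs = {(l, u). l ^ (q + 1) = 1 \<and> l * u ^ q = - u}"

lemma norm_pairsD:
  assumes "(l, u) \<in> norm_pairs"
  shows "l ^ (q + 1) = 1" "l * u ^ q = - u" "u ^ (q ^ 2) = u"
    "l ^ (q ^ i) * u ^ (q ^ Suc i) = - (u ^ (q ^ i))"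
proof -
  show l: "l ^ (q + 1) = 1" and u: "l * u ^ q = - u"
    using assms by (auto simp: norm_pairs_def)
  have "(l * u ^ q) ^ (q ^ i) = (- u) ^ (q ^ i)" for i
    using u by simp
  then show *: "l ^ (q ^ i) * u ^ (q ^ Suc i) = - (u ^ (q ^ i))" for i
    by (simp add: power_mult_distrib frob_uminus power_mult)
  have "l ^ q * u ^ (q ^ 2) = - (u ^ q)"
    using *[of 1] by (simp add: power2_eq_square)
  then have "l * (l ^ q * u ^ (q ^ 2)) = u"
    using u by simp
  then show "u ^ (q ^ 2) = u"
    using l by (simp flip: mult.assoc)
qed

lemma q_square_factor:
  obtains K where "(q ^ 2 - 1) * K = q ^ (2 * n) - 1"
proof -
  obtain b where b: "q ^ 2 = Suc b"
    using q_ge by (cases "q ^ 2") auto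
  have "b * (\<Sum>i<n. Suc b ^ i) + 1 = Suc b ^ n"
    by (induction n) (simp_all add: algebra_simps)
  then have "(q ^ 2 - 1) * (\<Sum>i<n. Suc b ^ i) = q ^ (2 * n) - 1"
    by (simp add: b power_mult)
  then show ?thesis
    by (rule that)
qed

text \<open>There are \<open>q + 1\<close> choices of \<open>l\<close>. For each, \<open>u\<close>
  is 0 or one of the \<open>q - 1\<close> solutions of \<open>u ^ (q - 1) = - 1 / l\<close>.\<close>

lemma card_norm_pairs: "card norm_pairs = (q + 1) * q"
proof -
  obtain K where K: "(q ^ 2 - 1) * K = q ^ (2 * n) - 1"
    by (rule q_square_factor)
  have sq: "q ^ 2 - 1 = (q + 1) * (q - 1)"
    by (simp add: power2_eq_square algebra_simps)
  have e1: "(q + 1) * ((q - 1) * K) = q ^ (2 * n) - 1"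
    using K unfolding sq by (simp only: mult.assoc)
  have e2: "(q - 1) * ((q + 1) * K) = q ^ (2 * n) - 1"
    using K unfolding sq by (simp only: mult_ac)
  have "card {l :: 'a. l ^ (q + 1) = 1} = q + 1"
    by (rule card_power_roots[OF e1]) simp
  moreover have "card {u :: 'a. l * u ^ q = - u} = q" if l: "l ^ (q + 1) = 1" for l
  proof -
    have "l \<noteq> 0"
      using norm_1_frob(2)[OF l] .
    have "(- 1 / l) ^ (q + 1) = (- 1) ^ (q + 1)"
      using l by (simp only: power_divide) simp
    \<comment> \<open>Frobenius fixes -1 in every characteristic, so this covers even
      \<open>q\<close> as well.\<close>
    also have "\<dots> = 1"
      using frob_uminus[of 1 1] by simp
    finally have "(- 1 / l) ^ ((q + 1) * K) = 1"
      by (simp only: power_mult power_one)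
    then have c: "card {u. u ^ (q - 1) = - 1 / l} = q - 1"
      by (rule card_power_roots[OF e2])
    have "l * u ^ q = - u \<longleftrightarrow> u = 0 \<or> u ^ (q - 1) = - 1 / l" for u
    proof -
      have "u ^ q = u * u ^ (q - 1)"
        using q_ge by (simp flip: power_Suc)
      then have "l * u ^ q = - u \<longleftrightarrow> u * (l * u ^ (q - 1) + 1) = 0"
        by (auto simp: algebra_simps eq_neg_iff_add_eq_0)
      also have "l * u ^ (q - 1) + 1 = l * (u ^ (q - 1) - (- 1 / l))"
        using \<open>l \<noteq> 0\<close> by (simp add: field_simps)
      also have "u * \<dots> = 0 \<longleftrightarrow> u = 0 \<or> u ^ (q - 1) = - 1 / l"
        using \<open>l \<noteq> 0\<close> by (simp only: mult_eq_0_iff right_minus_eq simp_thms)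
      finally show ?thesis .
    qed
    then have "{u. l * u ^ q = - u} = insert 0 {u. u ^ (q - 1) = - 1 / l}"
      by auto
    moreover have "0 \<notin> {u. u ^ (q - 1) = - 1 / l}"
      using q_ge \<open>l \<noteq> 0\<close> by (auto simp: power_0_left)
    ultimately show ?thesis
      using c q_ge by simp
  qed
  moreover have "norm_pairs = Sigma {l. l ^ (q + 1) = 1} (\<lambda>l. {u. l * u ^ q = - u})"
    by (auto simp: norm_pairs_def)
  ultimately show ?thesis
    by (simp add: card_SigmaI del: power_Suc)
qed

section \<open>The admissible values of \<open>y\<close>: the subfield with \<open>q ^ 2\<close>
  elements and the branches\<close>

definition subfield :: "'a set" where
  "subfield = {y. y ^ (q ^ 2) = y}"

lemma card_subfield: "card subfield = q ^ 2"
proof -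
  obtain K where K: "(q ^ 2 - 1) * K = q ^ (2 * n) - 1"
    by (rule q_square_factor)
  have q2: "q ^ 2 > 1"
    using q_ge by (intro one_less_power) auto
  have "card {y :: 'a. y ^ (q ^ 2 - 1) = 1} = q ^ 2 - 1"
    by (rule card_power_roots[OF K]) simp
  moreover have "subfield = insert 0 {y. y ^ (q ^ 2 - 1) = 1}"
  proof -
    have "Suc (q ^ 2 - 1) = q ^ 2"
      using q2 by linarith
    then have "y ^ (q ^ 2) = y * y ^ (q ^ 2 - 1)" for y :: 'a
      by (metis power_Suc)
    then show ?thesis
      using q2 by (auto simp: subfield_def)
  qed
  moreover have "0 \<notin> {y :: 'a. y ^ (q ^ 2 - 1) = 1}"
    using q2 by (auto simp: power_0_left)
  ultimately show ?thesis
    using q2 by simp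
qed

definition branch :: "'a \<times> 'a \<Rightarrow> 'a set" where
  "branch = (\<lambda>(l, u). {y. y ^ (q ^ n) - l * y = u})"

text \<open>The map sending \<open>y\<close> to \<open>y ^ (q ^ n) - l * y\<close> has fibres of
  size at most \<open>q ^ n\<close> and lands among the at most \<open>q ^ n\<close> zeros of
  \<open>u ^ (q ^ n) + inverse l * u\<close>. The field has \<open>q ^ n * q ^ n\<close> elements,
  so the fibres are full.\<close>

lemma card_branch:
  assumes "(l, u) \<in> norm_pairs"
  shows "card (branch (l, u)) = q ^ n"
proof -
  note l = norm_pairsD(1)[OF assms]
  have ln: "l ^ (q ^ n) * l = 1"
    using frob_odd[OF norm_1_frob(3)[OF l]] l by (simp add: mult.commute)
  have qn: "q ^ n \<ge> 2"
    using q_ge n_pos by (metis le_trans self_le_power less_le_trans zero_less_numeral le_numeral_extra(4) one_le_numeral)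
  have "card {y \<in> UNIV. y ^ (q ^ n) - l * y = u} = q ^ n"
  proof (rule card_fibre_eq[where B = "{u. u ^ (q ^ n) + inverse l * u = 0}"])
    show "(\<lambda>y. y ^ (q ^ n) - l * y) ` UNIV \<subseteq> {u. u ^ (q ^ n) + inverse l * u = 0}"
    proof safe
      fix y :: 'a
      have "l * (y ^ (q ^ n) - l * y) ^ (q ^ n) = l * y ^ (q ^ (n + n)) - (l ^ (q ^ n) * l) * y ^ (q ^ n)"
        by (simp only: frob_diff power_mult_distrib frob_frob) (simp add: algebra_simps)
      also have "\<dots> = - (y ^ (q ^ n) - l * y)"
        using power_card[of y] by (simp add: ln mult_2)
      finally have *: "l * (y ^ (q ^ n) - l * y) ^ (q ^ n) = - (y ^ (q ^ n) - l * y)" .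
      have "(y ^ (q ^ n) - l * y) ^ (q ^ n) + inverse l * (y ^ (q ^ n) - l * y) =
          inverse l * (l * (y ^ (q ^ n) - l * y) ^ (q ^ n) + (y ^ (q ^ n) - l * y))"
        using norm_1_frob(2)[OF l] by (simp add: distrib_left flip: mult.assoc)
      then show "(y ^ (q ^ n) - l * y) ^ (q ^ n) + inverse l * (y ^ (q ^ n) - l * y) = 0"
        unfolding * by simp
    qed
    show "card {y \<in> UNIV. y ^ (q ^ n) - l * y = b} \<le> q ^ n" for b
      using card_roots_linearized_le[OF qn, of "- l" b] by simp
    have "q ^ n * card {u. u ^ (q ^ n) + inverse l * u = 0} \<le> q ^ n * q ^ n"
      using card_roots_linearized_le[OF qn, of "inverse l" 0] by simp
    then show "q ^ n * card {u. u ^ (q ^ n) + inverse l * u = 0} \<le> CARD('a)"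
      by (simp add: card_F mult_2 power_add)
    have "l * (u ^ (q ^ n) + inverse l * u) = 0"
      using frob_odd[OF norm_pairsD(3)[OF assms]] norm_pairsD(2)[OF assms] norm_1_frob(2)[OF l]
      by (simp add: algebra_simps)
    then show "u \<in> {u. u ^ (q ^ n) + inverse l * u = 0}"
      using norm_1_frob(2)[OF l] by simp
  qed auto
  then show ?thesis
    by (simp add: branch_def)
qed

text \<open>On the subfield \<open>y ^ (q ^ n)\<close> is \<open>y ^ q\<close>, so the branch
  equation has degree \<open>q\<close> there.\<close>

lemma card_branch_subfield: "card (branch (l, u) \<inter> subfield) \<le> q"
proof -
  have "branch (l, u) \<inter> subfield \<subseteq> {y. y ^ q + (- l) * y = u}"
    using frob_odd by (auto simp: branch_def subfield_def)
  then have "card (branch (l, u) \<inter> subfield) \<le> card {y. y ^ q + (- l) * y = u}"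
    by (intro card_mono) auto
  then show ?thesis
    using card_roots_linearized_le[OF q_ge, of "- l" u] by linarith
qed

text \<open>Both \<open>l\<close> and \<open>u\<close> are fixed by the
  \<open>q ^ 2\<close>-Frobenius, so applying it to the branch equation and subtracting cancels
  \<open>u\<close>. This recovers \<open>l\<close> from \<open>y\<close> and makes
  \<open>y ^ (q ^ 2) - y\<close> an \<open>m\<close>-th power.\<close>

lemma branch_frob:
  assumes "(l, u) \<in> norm_pairs" "y \<in> branch (l, u)"
  shows "(y ^ (q ^ 2) - y) ^ (q ^ n) = l * (y ^ (q ^ 2) - y)"
proof -
  have y: "y ^ (q ^ n) = l * y + u"
    using assms(2) by (simp add: branch_def algebra_simps)
  have "(y ^ (q ^ 2)) ^ (q ^ n) = (y ^ (q ^ n)) ^ (q ^ 2)"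
    by (simp add: mult.commute flip: power_mult)
  also have "\<dots> = l * y ^ (q ^ 2) + u"
    unfolding y frob_add power_mult_distrib
    using norm_1_frob(3)[OF norm_pairsD(1)[OF assms(1)]] norm_pairsD(3)[OF assms(1)] by simp
  finally show ?thesis
    by (simp add: frob_diff y algebra_simps)
qed

text \<open>Split the sum of the \<open>Y i * Y (Suc i)\<close> into halves of length
  \<open>n\<close>. As \<open>n\<close> is odd, the halves have opposite signs, and by
  \<open>step\<close> their quadratic parts cancel. The linear part telescopes to \<open>K\<close>
  and the constant part contributes \<open>- K\<close>.\<close>

lemma alt_trace_branch:
  assumes "(l, u) \<in> norm_pairs" "y \<in> branch (l, u)"
  shows "alt_trace (y ^ (q + 1)) = 0"
proof -
  define Y where "Y i = y ^ (q ^ i)" for i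
  define U where "U i = u ^ (q ^ i)" for i
  define l' where "l' i = l ^ (q ^ i)" for i
  define K where "K = u * u ^ q"
  have y: "y ^ (q ^ n) = l * y + u"
    using assms(2) by (simp add: branch_def algebra_simps)
  have Yn: "Y (n + i) = l' i * Y i + U i" for i
    unfolding Y_def l'_def U_def frob_frob[symmetric] y by (simp add: frob_add power_mult_distrib)
  have ll: "l' i * l' (Suc i) = 1" for i
    unfolding l'_def by (rule norm_1_frob(1)[OF norm_pairsD(1)[OF assms(1)]])
  have lU: "l' i * U (Suc i) = - U i" for i
    unfolding l'_def U_def by (rule norm_pairsD(4)[OF assms(1)])
  have Ul: "U i * l' (Suc i) = - U (Suc i)" for i
  proof -
    have "- U i * l' (Suc i) = (l' i * l' (Suc i)) * U (Suc i)"
      unfolding lU[symmetric] by (simp add: mult_ac)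
    then show ?thesis
      unfolding ll by (simp add: minus_equation_iff)
  qed
  have UU: "U i * U (Suc i) = K" for i
  proof (induction i)
    case (Suc i)
    have "U (Suc (Suc i)) = (u ^ (q ^ 2)) ^ (q ^ i)"
      by (simp add: U_def power2_eq_square mult_ac flip: power_mult)
    then have "U (Suc (Suc i)) = U i"
      using norm_pairsD(3)[OF assms(1)] by (simp add: U_def)
    with Suc show ?case by (simp add: mult.commute)
  qed (simp add: K_def U_def)
  have step: "Y (n + i) * Y (n + Suc i) = Y i * Y (Suc i) - (U i * Y i + U (Suc i) * Y (Suc i)) + K" for i
  proof -
    have "Y (n + i) * Y (n + Suc i) = (l' i * l' (Suc i)) * (Y i * Y (Suc i)) +
        (l' i * U (Suc i)) * Y i + (U i * l' (Suc i)) * Y (Suc i) + U i * U (Suc i)"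
      unfolding Yn by (simp add: algebra_simps)
    then show ?thesis
      unfolding ll lU Ul UU by (simp add: algebra_simps)
  qed
  have "(\<Sum>i<n. (-1) ^ i * (U i * Y i + U (Suc i) * Y (Suc i))) = U 0 * Y 0 + U n * Y n"
    using sum_alternating_telescope[of "\<lambda>i. U i * Y i" n] n by simp
  also have "U n * Y n = u ^ q * (l * y + u)"
    using frob_odd[OF norm_pairsD(3)[OF assms(1)]] y by (simp add: U_def Y_def)
  also have "\<dots> = (l * u ^ q) * y + K"
    by (simp add: K_def algebra_simps)
  also have "l * u ^ q = - u"
    by (rule norm_pairsD(2)[OF assms(1)])
  finally have tele: "(\<Sum>i<n. (-1) ^ i * (U i * Y i + U (Suc i) * Y (Suc i))) = K"
    by (simp add: U_def Y_def)
  have "alt_trace (y ^ (q + 1)) = (\<Sum>i<n + n. (-1) ^ i * (Y i * Y (Suc i)))"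
    unfolding alt_trace_def Y_def mult_2
    by (intro sum.cong) (simp_all add: power_mult_distrib power_mult mult.commute)
  also have "\<dots> = (\<Sum>i<n. (-1) ^ i * (Y i * Y (Suc i))) +
      (\<Sum>i<n. (-1) ^ (n + i) * (Y (n + i) * Y (Suc (n + i))))"
    by (rule sum_lessThan_add)
  also have "(\<Sum>i<n. (-1) ^ (n + i) * (Y (n + i) * Y (Suc (n + i)))) =
      (\<Sum>i<n. (-1) ^ i * (U i * Y i + U (Suc i) * Y (Suc i)) - (-1) ^ i * (Y i * Y (Suc i)) - (-1) ^ i * K)"
    unfolding add_Suc_right[symmetric] step using n
    by (intro sum.cong) (simp_all add: power_add algebra_simps)
  also have "\<dots> = K - (\<Sum>i<n. (-1) ^ i * (Y i * Y (Suc i))) - K"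
    using n by (simp only: sum_subtractf tele sum_alternating_const if_False)
  finally show ?thesis by simp
qed

text \<open>Here \<open>y ^ (q + 1)\<close> is a norm to the field with \<open>q\<close> elements,
  so all terms are equal up to sign and an even number of them cancels.\<close>

lemma alt_trace_subfield:
  assumes "y \<in> subfield"
  shows "alt_trace (y ^ (q + 1)) = 0"
proof -
  have "(y ^ (q + 1)) ^ q = y ^ (q ^ 2) * y ^ q"
    by (simp add: power_mult_distrib power2_eq_square mult.commute flip: power_mult)
  then have c: "(y ^ (q + 1)) ^ q = y ^ (q + 1)"
    using assms by (simp add: subfield_def)
  have "(y ^ (q + 1)) ^ (q ^ i) = y ^ (q + 1)" for i
  proof (induction i)
    case (Suc i)
    have "(y ^ (q + 1)) ^ (q ^ Suc i) = ((y ^ (q + 1)) ^ q) ^ (q ^ i)"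
      by (simp only: power_Suc power_mult)
    then show ?case
      using Suc by (simp only: c)
  qed simp
  then show ?thesis
    unfolding alt_trace_def by (simp only: sum_alternating_const) simp
qed

section \<open>A lower bound for the number of affine points\<close>

definition points :: "nat \<Rightarrow> ('a \<times> 'a \<times> 'a) set" where
  "points m = {(x, y, z). x ^ q + x = y ^ (q + 1) \<and> y ^ (q ^ 2) - y = z ^ m}"

definition branches :: "'a set" where
  "branches = (\<Union>b\<in>norm_pairs. branch b - subfield)"

text \<open>Off the subfield the branches are disjoint: \<open>y\<close> determines \<open>l\<close>
  by \<open>branch_frob\<close>, and then \<open>u\<close>.\<close>

lemma card_branches: "card branches \<ge> (q + 1) * q * (q ^ n - q)"
proof -
  have disj: "(branch b - subfield) \<inter> (branch b' - subfield) = {}"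
    if "b \<in> norm_pairs" "b' \<in> norm_pairs" "b \<noteq> b'" for b b'
  proof (rule ccontr)
    assume "(branch b - subfield) \<inter> (branch b' - subfield) \<noteq> {}"
    then obtain y where y: "y \<in> branch b" "y \<in> branch b'" "y \<notin> subfield" by blast
    obtain l u l' u' where b: "b = (l, u)" "b' = (l', u')" by fastforce
    have "l * (y ^ (q ^ 2) - y) = l' * (y ^ (q ^ 2) - y)"
      using branch_frob that(1,2) y(1,2) unfolding b by metis
    then have "l = l'"
      using y(3) by (simp add: subfield_def)
    then have "u = u'"
      using y(1,2) unfolding b branch_def by auto
    with \<open>l = l'\<close> that(3) b show False by simp
  qed
  have "(q + 1) * q * (q ^ n - q) = (\<Sum>b\<in>norm_pairs. q ^ n - q)"
    by (simp add: card_norm_pairs)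
  also have "\<dots> \<le> (\<Sum>b\<in>norm_pairs. card (branch b - subfield))"
  proof (rule sum_mono)
    fix b assume b: "b \<in> norm_pairs"
    obtain l u where lu: "b = (l, u)" by fastforce
    have "card (branch b - subfield) = card (branch b) - card (branch b \<inter> subfield)"
      by (rule card_Diff_subset_Int) simp
    then show "q ^ n - q \<le> card (branch b - subfield)"
      using card_branch[of l u] card_branch_subfield[of l u] b lu by simp
  qed
  also have "\<dots> = card branches"
    unfolding branches_def using disj by (intro card_UN_disjoint[symmetric]) auto
  finally show ?thesis .
qed

text \<open>Each \<open>y\<close> counted has \<open>q\<close> values of \<open>x\<close>, by the
  vanishing of the alternating trace. It has one value of \<open>z\<close> in the subfield and
  \<open>m\<close> values on a branch off it.\<close>

lemma card_points:
  assumes m: "m * (q + 1) = q ^ n + 1" and n3: "n \<ge> 3"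
  shows "int (card (points m)) \<ge> int q ^ (2 * n + 2) - int q ^ (n + 3) + int q ^ (n + 2)"
proof -
  define Xs where "Xs y = {x. x ^ q + x = y ^ (q + 1)}" for y :: 'a
  define Zs where "Zs y = {z. z ^ m = y ^ (q ^ 2) - y}" for y :: 'a
  have m_pos: "m > 0"
    using m by (cases m) auto
  have "points m = (\<lambda>(y, x, z). (x, y, z)) ` (SIGMA y:UNIV. Xs y \<times> Zs y)"
    by (auto simp: points_def Xs_def Zs_def image_iff)
  then have "card (points m) = card (SIGMA y:UNIV. Xs y \<times> Zs y)"
    by (simp add: card_image inj_on_def)
  also have "\<dots> = (\<Sum>y\<in>UNIV. card (Xs y) * card (Zs y))"
    by (subst card_SigmaI) (auto simp: card_cartesian_product)
  also have "\<dots> \<ge> (\<Sum>y\<in>subfield \<union> branches. card (Xs y) * card (Zs y))"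
    by (intro sum_mono2) auto
  also have "(\<Sum>y\<in>subfield \<union> branches. card (Xs y) * card (Zs y)) =
      (\<Sum>y\<in>subfield. card (Xs y) * card (Zs y)) + (\<Sum>y\<in>branches. card (Xs y) * card (Zs y))"
    by (rule sum.union_disjoint) (auto simp: branches_def)
  also have "(\<Sum>y\<in>subfield. card (Xs y) * card (Zs y)) = (\<Sum>y\<in>subfield. q)"
  proof (rule sum.cong[OF refl])
    fix y assume y: "y \<in> subfield"
    have "Zs y = {0}"
      using y m_pos by (auto simp: Zs_def subfield_def power_0_left)
    then show "card (Xs y) * card (Zs y) = q"
      using card_artin_schreier_roots[OF alt_trace_subfield[OF y]] by (simp add: Xs_def)
  qed
  also have "(\<Sum>y\<in>branches. card (Xs y) * card (Zs y)) = (\<Sum>y\<in>branches. q * m)"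
  proof (rule sum.cong[OF refl])
    fix y assume "y \<in> branches"
    then obtain l u where lu: "(l, u) \<in> norm_pairs" "y \<in> branch (l, u)" "y \<notin> subfield"
      by (auto simp: branches_def)
    define w where "w = y ^ (q ^ 2) - y"
    have "w \<noteq> 0"
      using lu(3) by (simp add: w_def subfield_def)
    have "w * w ^ (q ^ n - 1) = w ^ (q ^ n)"
      using q_ge by (simp flip: power_Suc)
    also have "\<dots> = w * l"
      using branch_frob[OF lu(1,2)] by (simp add: w_def mult.commute)
    finally have "w ^ (q ^ n - 1) = l"
      using \<open>w \<noteq> 0\<close> by simp
    then have "w ^ ((q ^ n - 1) * (q + 1)) = 1"
      using norm_pairsD(1)[OF lu(1)] by (simp only: power_mult)
    \<comment> \<open>This is the factorization that lets \<open>card_power_roots\<close> count the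
      \<open>m\<close>-th roots of \<open>w\<close>.\<close>
    moreover have "m * ((q ^ n - 1) * (q + 1)) = q ^ (2 * n) - 1"
    proof -
      have "m * ((q ^ n - 1) * (q + 1)) = (m * (q + 1)) * (q ^ n - 1)"
        by (simp only: mult_ac)
      also have "\<dots> = q ^ (2 * n) - 1"
        unfolding m mult_2 power_add by (simp add: algebra_simps)
      finally show ?thesis .
    qed
    ultimately have "card (Zs y) = m"
      unfolding Zs_def w_def[symmetric] by (intro card_power_roots)
    then show "card (Xs y) * card (Zs y) = q * m"
      using card_artin_schreier_roots[OF alt_trace_branch[OF lu(1,2)]] by (simp add: Xs_def)
  qed
  finally have "q ^ 2 * q + card branches * (q * m) \<le> card (points m)"
    by (simp add: card_subfield)
  moreover have "((q + 1) * q * (q ^ n - q)) * (q * m) \<le> card branches * (q * m)"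
    using card_branches by (intro mult_right_mono) auto
  ultimately have "q ^ 2 * q + ((q + 1) * q * (q ^ n - q)) * (q * m) \<le> card (points m)"
    by linarith
  moreover have "((q + 1) * q * (q ^ n - q)) * (q * m) = q ^ 2 * (q ^ n - q) * (m * (q + 1))"
    by (simp only: power2_eq_square mult_ac)
  ultimately have "int (q ^ 2 * q + q ^ 2 * (q ^ n - q) * (q ^ n + 1)) \<le> int (card (points m))"
    unfolding m by (simp only: of_nat_le_iff)
  moreover have "int (q ^ n - q) = int q ^ n - int q"
    using self_le_power[of q n] q_ge n_pos by (simp add: of_nat_diff)
  ultimately have "int q ^ 2 * int q + int q ^ 2 * (int q ^ n - int q) * (int q ^ n + 1) \<le> int (card (points m))"
    by (simp only: of_nat_add of_nat_mult of_nat_power of_nat_1)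
  moreover have "int q ^ 2 * int q + int q ^ 2 * (int q ^ n - int q) * (int q ^ n + 1) =
      int q ^ (2 * n + 2) - int q ^ (n + 3) + int q ^ (n + 2)"
    unfolding mult_2 power_add
    by (simp add: power2_eq_square power3_eq_cube algebra_simps)
  ultimately show ?thesis by simp
qed

end

section \<open>Finite fields as types\<close>

text \<open>The polynomial X^Q - X splits into linear factors, and a repeated root would be a root
  of its derivative, which is -1.\<close>

lemma card_frobenius_fixed_points:
  fixes k :: nat
  assumes "prime CHAR('a::alg_closed_field)" and "k > 0"
  shows "card {x::'a. x ^ (CHAR('a) ^ k) = x} = CHAR('a) ^ k"
proof -
  define Q where "Q = CHAR('a) ^ k"
  have "Q > 1"
    using assms prime_gt_1_nat one_less_power unfolding Q_def by blast
  have Q0: "of_nat Q = (0::'a)"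
    using assms by (simp add: Q_def)
  define p :: "'a poly" where "p = monom 1 Q - monom 1 1"
  have deg: "degree p = Q"
    unfolding p_def diff_conv_add_uminus using \<open>Q > 1\<close>
    by (subst degree_add_eq_left) (simp_all add: degree_monom_eq)
  have lead: "lead_coeff p = 1"
    unfolding deg unfolding p_def using \<open>Q > 1\<close> by simp
  have poly_p: "poly p x = x ^ Q - x" for x
    by (simp add: p_def poly_monom)
  have pd: "pderiv p = - 1"
    using Q0 by (simp add: p_def pderiv_diff pderiv_monom) 
  have "p \<noteq> 0"
    using lead by auto
  then obtain A where A: "size A = Q" "p = (\<Prod>x\<in>#A. [:-x, 1:])"
    using alg_closed_imp_factorization[of p] lead deg by auto
  have "count A x \<le> 1" for x
  proof (rule ccontr)
    assume "\<not> count A x \<le> 1"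
    then have "{#x, x#} \<subseteq># A"
      by (simp add: subseteq_mset_def)
    then obtain B where "A = {#x, x#} + B"
      by (auto simp: mset_subset_eq_exists_conv)
    then have "p = [:-x, 1:] * ([:-x, 1:] * (\<Prod>x\<in>#B. [:-x, 1:]))"
      by (simp add: A(2))
    then have "poly (pderiv p) x = 0"
      by (simp only: pderiv_mult) simp
    with pd show False by simp
  qed
  then have "card (set_mset A) = size A"
    by (metis count_greater_eq_one_iff le_antisym size_multiset_overloaded_eq sum.cong card_eq_sum)
  moreover have "set_mset A = {x. poly p x = 0}"
    unfolding A(2) by (auto simp: poly_prod_mset prod_mset_zero_iff)
  ultimately show ?thesis
    using A(1) by (simp add: poly_p Q_def)
qed

section \<open>Reduction of the claim to a single field size\<close>

definition codes_over :: "nat \<Rightarrow> bool" where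
  "codes_over Q \<longleftrightarrow> (\<forall>q n N s g l. Q = q ^ (2 * n) \<longrightarrow> n \<ge> 5 \<longrightarrow> odd n \<longrightarrow>
     2 * g = (int q - 1) * (int q ^ (n + 1) + int q ^ n - int q ^ 2) \<longrightarrow>
     int N = int q ^ (2 * n + 2) - int q ^ (n + 3) + int q ^ (n + 2) \<longrightarrow>
     l \<in> {3 * g - 1..int N - g} \<longrightarrow> int s \<in> {1..int N - 2 * l} \<longrightarrow>
     (\<exists>D V. quantum_code Q N s D V \<and> int D \<ge> l + 1 - g))"

text \<open>
  The development above works with a finite field that is a type, but a type cannot depend on the
  field size. It is enough to have such a type for one size: that of a counterexample, if there is
  one.
\<close>
definition crit_card :: nat where
  "crit_card = (if \<exists>Q. primepow Q \<and> \<not> codes_over Q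
                then SOME Q. primepow Q \<and> \<not> codes_over Q else 2)"

text \<open>The default value 2 is a prime power too, so the field type exists whether or not there
  is a counterexample.\<close>

lemma primepow_crit_card: "primepow crit_card"
  using someI_ex[of "\<lambda>Q. primepow Q \<and> \<not> codes_over Q"] by (auto simp: crit_card_def)

lemma codes_over_if_crit:
  assumes "codes_over crit_card" "primepow Q"
  shows "codes_over Q"
  using assms someI_ex[of "\<lambda>Q. primepow Q \<and> \<not> codes_over Q"]
  by (auto simp: crit_card_def split: if_splits)

text \<open>A type of prime cardinality p, so that \<open>mod_ring\<close> supplies the prime field
  of characteristic p.\<close>

typedef crit_prime = "{..<aprimedivisor crit_card}"
  using aprimedivisor_pos_nat[of crit_card] primepow_gt_Suc_0[OF primepow_crit_card]
  by (intro exI[of _ 0]) simp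

lemma card_crit_prime: "CARD(crit_prime) = aprimedivisor crit_card"
  using type_definition.card[OF type_definition_crit_prime] by simp

instance crit_prime :: prime_card
  by standard (use aprimedivisor_nat(1)[of crit_card] primepow_gt_Suc_0[OF primepow_crit_card] in
    \<open>simp add: card_crit_prime\<close>)

type_synonym crit_closure = "crit_prime mod_ring alg_closure"

lemma CHAR_crit_closure: "CHAR(crit_closure) = aprimedivisor crit_card"
  by (simp add: card_crit_prime)

lemma crit_card_eq_CHAR_power:
  obtains k where "k > 0" "crit_card = CHAR(crit_closure) ^ k"
proof
  let ?k = "multiplicity (aprimedivisor crit_card) crit_card"
  show *: "crit_card = CHAR(crit_closure) ^ ?k"
    unfolding CHAR_crit_closure using primepow_decompose[OF primepow_crit_card] by simp
  show "?k > 0"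
    using * primepow_gt_Suc_0[OF primepow_crit_card] by (cases "?k = 0") auto
qed

lemma prime_CHAR_crit_closure: "prime CHAR(crit_closure)"
  using CHAR_crit_closure card_crit_prime prime_card[where 'a = crit_prime] by simp

text \<open>Since \<open>crit_card\<close> is a power of the characteristic, the fixed points of
  this power map form a subfield of the closure.\<close>

typedef crit_field = "{x :: crit_closure. x ^ crit_card = x}"
  by (rule exI[of _ 1]) simp

setup_lifting type_definition_crit_field

lemma crit_frobenius_add: "(x + y :: crit_closure) ^ crit_card = x ^ crit_card + y ^ crit_card"
  by (metis crit_card_eq_CHAR_power freshmans_dream' prime_CHAR_crit_closure)

lemma crit_frobenius_minus: "(- x :: crit_closure) ^ crit_card = - (x ^ crit_card)"
proof -
  have "(x + - x) ^ crit_card = x ^ crit_card + (- x) ^ crit_card"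
    by (rule crit_frobenius_add)
  moreover have "(x + - x) ^ crit_card = 0"
    using primepow_gt_0_nat[OF primepow_crit_card] by simp
  ultimately show ?thesis
    by (simp add: eq_neg_iff_add_eq_0 add.commute)
qed

instantiation crit_field :: field
begin
lift_definition zero_crit_field :: crit_field is 0
  using primepow_gt_0_nat[OF primepow_crit_card] by simp
lift_definition one_crit_field :: crit_field is 1 by simp
lift_definition uminus_crit_field :: "crit_field \<Rightarrow> crit_field" is uminus
  by (simp add: crit_frobenius_minus)
lift_definition plus_crit_field :: "crit_field \<Rightarrow> crit_field \<Rightarrow> crit_field" is "(+)"
  by (simp add: crit_frobenius_add)
lift_definition minus_crit_field :: "crit_field \<Rightarrow> crit_field \<Rightarrow> crit_field" is "(-)"
  unfolding diff_conv_add_uminus by (simp only: crit_frobenius_add crit_frobenius_minus)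
lift_definition times_crit_field :: "crit_field \<Rightarrow> crit_field \<Rightarrow> crit_field" is "(*)"
  by (simp add: power_mult_distrib)
lift_definition inverse_crit_field :: "crit_field \<Rightarrow> crit_field" is inverse
  by (simp add: power_inverse)
lift_definition divide_crit_field :: "crit_field \<Rightarrow> crit_field \<Rightarrow> crit_field" is "(/)"
  by (simp add: power_divide)

instance
  by standard (transfer; simp add: algebra_simps divide_inverse)+

end

lemma card_crit_field: "CARD(crit_field) = crit_card"
proof -
  obtain k where "k > 0" "crit_card = CHAR(crit_closure) ^ k"
    by (rule crit_card_eq_CHAR_power)
  thus ?thesis
    using card_frobenius_fixed_points[of k, where 'a = crit_closure] prime_CHAR_crit_closure
      type_definition.card[OF type_definition_crit_field] by metis
qed

instance crit_field :: finite_field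
  by (rule finite_fieldI) (metis card_crit_field card.infinite primepow_crit_card zero_not_primepow)

text \<open>Modulo \<open>q + 1\<close>, \<open>q\<close> is -1, and \<open>n\<close> is odd. This
  provides the exponent \<open>m\<close> of the curve.\<close>

lemma add_one_dvd_power_add_one:
  fixes q n :: nat
  assumes "odd n"
  shows "q + 1 dvd q ^ n + 1"
proof -
  have "[int q ^ n = (- 1) ^ n] (mod (int q + 1))"
    by (intro cong_pow) (simp add: cong_iff_dvd_diff)
  then have "int q + 1 dvd int q ^ n + 1"
    using assms by (simp add: cong_iff_dvd_diff)
  then have "int (q + 1) dvd int (q ^ n + 1)"
    by (simp add: add.commute)
  then show ?thesis
    by (simp only: of_nat_dvd_iff)
qed

lemma codes_over_crit_card: "codes_over crit_card"
  unfolding codes_over_def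
proof (intro allI impI)
  fix q n N s :: nat and g l :: int
  assume Q: "crit_card = q ^ (2 * n)" and hn: "n \<ge> 5" "odd n"
    and g: "2 * g = (int q - 1) * (int q ^ (n + 1) + int q ^ n - int q ^ 2)"
    and N: "int N = int q ^ (2 * n + 2) - int q ^ (n + 3) + int q ^ (n + 2)"
    and l: "l \<in> {3 * g - 1..int N - g}" and s: "int s \<in> {1..int N - 2 * l}"
  have "q > 0"
    using primepow_gt_0_nat[OF primepow_crit_card] hn Q by (cases q) (auto simp: power_0_left)
  then have "primepow q"
    using primepow_crit_card unfolding Q by (simp add: primepow_power_iff_nat)
  interpret square_field q n "TYPE(crit_field)"
    by unfold_locales (use \<open>primepow q\<close> hn Q card_crit_field in auto)
  have "g > 0"
  proof -
    have "int q ^ 2 \<le> int q ^ (n + 1)"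
      using q_ge hn by (intro power_increasing) auto
    moreover have "int q ^ n > 0"
      using q_ge by simp
    ultimately have "int q ^ (n + 1) + int q ^ n - int q ^ 2 > 0"
      by linarith
    then have "(int q - 1) * (int q ^ (n + 1) + int q ^ n - int q ^ 2) > 0"
      using q_ge by (intro mult_pos_pos) linarith+
    then show ?thesis
      using g by simp
  qed
  then obtain G where G: "g = int G" "G > 0"
    by (metis pos_int_cases)
  have "l \<ge> 0"
    using l \<open>g > 0\<close> by simp
  then obtain L where L: "l = int L"
    by (metis nonneg_int_cases)
  have bounds: "L + 1 \<ge> 3 * G" "s \<ge> 1" "2 * L + s \<le> N"
    using l s unfolding G L by auto
  obtain m where m: "m * (q + 1) = q ^ n + 1"
    using add_one_dvd_power_add_one[OF hn(2)] by (metis dvdE mult.commute)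
  have "N \<le> card (points m)"
    using card_points[OF m] hn N by linarith
  then obtain P where P: "P \<subseteq> points m" "card P = N" "finite P"
    by (metis obtain_subset_with_card_n)
  then obtain pt where pt: "bij_betw pt {..<N} P"
    using ex_bij_betw_nat_finite[OF P(3)] by (auto simp: atLeast0LessThan)
  \<comment> \<open>The default (0, 0, 0) lies on the curve, so the equations hold at every index,
    as \<open>ggs_ring\<close> demands.\<close>
  define x where "x i = (if i < N then fst (pt i) else 0)" for i
  define y where "y i = (if i < N then fst (snd (pt i)) else 0)" for i
  define z where "z i = (if i < N then snd (snd (pt i)) else 0)" for i
  have on_curve: "x i ^ q + x i = y i ^ (q + 1) \<and> y i ^ (q ^ 2) - y i = z i ^ m" for i
  proof (cases "i < N")
    case True
    then have "pt i \<in> points m"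
      using pt P(1) by (auto simp: bij_betw_def)
    then show ?thesis
      using True by (auto simp: points_def x_def y_def z_def)
  next
    case False
    have "m \<noteq> 0"
      using m by (cases m) auto
    with False show ?thesis
      using q_ge by (simp add: x_def y_def z_def power_0_left)
  qed
  interpret ggs_ring q n m x y z
    by unfold_locales (use q_ge hn m on_curve in auto)
  have "inj_on (\<lambda>i. (x i, y i, z i)) {..<N}"
    using pt by (auto simp: inj_on_def bij_betw_def x_def y_def z_def prod_eq_iff)
  then have "eval_filtration orders of_order {..<N} G"
    using g G by (intro filtration) auto
  \<comment> \<open>With \<open>a = L + G - 1\<close> and \<open>d = L + 1 - G\<close>, the
    interpolation bound \<open>d + 2 * G \<le> a + 2\<close> is an equality and
    \<open>d + a + s\<close> equals \<open>2 * L + s\<close>; the other conditions follow from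
    \<open>bounds\<close>.\<close>
  then have "\<exists>D V. quantum_code CARD(crit_field) N s D V \<and> D \<ge> L + 1 - G"
    by (rule eval_filtration_quantum_code[where a = "L + G - 1"]) (use bounds G(2) in linarith)+
  then obtain D V where "quantum_code crit_card N s D V" "D \<ge> L + 1 - G"
    by (auto simp: card_crit_field)
  moreover from this have "int D \<ge> l + 1 - g"
    unfolding G L by linarith
  ultimately show "\<exists>D V. quantum_code crit_card N s D V \<and> int D \<ge> l + 1 - g"
    by blast
qed

theorem theorem6p4:
  fixes q n N s :: nat and g l :: int
  assumes "primepow q"
    and "n \<ge> 5" and "odd n"
    and "2 * g = (int q - 1) * (int q ^ (n + 1) + int q ^ n - int q ^ 2)"
    and "int N = int q ^ (2 * n + 2) - int q ^ (n + 3) + int q ^ (n + 2)"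
    and "l \<in> {3 * g - 1..int N - g}"
    and "int s \<in> {1..int N - 2 * l}"
  shows "\<exists>D V. quantum_code (q ^ (2 * n)) N s D V \<and> int D \<ge> l + 1 - g"
proof -
  have "primepow (q ^ (2 * n))"
    using assms(1,2) primepow_gt_0_nat[OF assms(1)] by (simp add: primepow_power_iff_nat)
  then have "codes_over (q ^ (2 * n))"
    using codes_over_if_crit[OF codes_over_crit_card] by blast
  then show ?thesis
    using assms(2-) unfolding codes_over_def by blast
qed

end
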